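(* Let $B\in\mathbb{R}_+^{n\times n}$ be a row uniform nonnegative matrix with classes $B_1,\dots,B_p$ (the diagonal blocks of its Frobenius normal form), let $$\sigma(B)=\{\lambda\in\mathbb{C}: \exists A\in\mathbb{C}^{n\times n},\ \operatorname{Aux}(|A|)=B,\ \det(A-\lambda I)=0\},$$ and let $$\tilde M(B)=\max\{\mu(B_i): B_i\text{ is a transient class or a final multicyclic class of }B\}.$$ Then: (i) If $\tilde M(B)$ is attained at some final multicyclic class $B_s$ with $\nu(B_s)=\mu(B_s)$ (that is, $\mu(B_s)=\nu(B_s)=\tilde M(B)$ for some such class), then $$\sigma(B)\setminus\{0\}=\{s: 0<|s|\le\tilde M(B)\}\cup\bigcup_i\{s: |s|=\mu(B_i)\},$$ where the union is over all $i$ such that $B_i$ is a final unicyclic class and $\mu(B_i)>\tilde M(B)$. (ii) Otherwise, $$\sigma(B)\setminus\{0\}=\{s: 0<|s|<\tilde M(B)\}\cup\bigcup_i\{s: |s|=\mu(B_i)\},$$ where the union is over all $i$ such that $B_i$ is a final unicyclic class and $\mu(B_i)\ge\tilde M(B)$. (Here $s$ ranges over $\mathbb{C}$.)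
   Context: $\mathbb{R}_+$ denotes the nonnegative reals. For a complex matrix $A$, $|A|$ is the matrix of the moduli of its entries. For $A=(a_{ij})\in\mathbb{R}_+^{n\times n}$, the auxiliary matrix $\operatorname{Aux}(A)=(b_{ij})$ is defined by $b_{ij}=\sum_k a_{ik}$ if $a_{ij}\neq0$ and $b_{ij}=0$ if $a_{ij}=0$. A nonnegative matrix is row uniform if, in every row, all nonzero entries are equal. The associated digraph $\mathcal{G}(B)$ has nodes $\{1,\dots,n\}$ and an edge $(i,j)$ of weight $b_{ij}$ exactly when $b_{ij}\neq0$ (loops allowed). $\mu$ and $\nu$ of a nonnegative matrix denote respectively the maximum and the minimum, over all cycles $(i_1,\dots,i_\ell)$ of its digraph, of the cycle geometric mean $(b_{i_1i_2}b_{i_2i_3}\cdots b_{i_\ell i_1})^{1/\ell}$ (both are $0$ if there are no cycles). The classes of $B$ are the principal submatrices $B_i$ of $B$ on the node sets of the maximal strongly connected components of $\mathcal{G}(B)$. A class is final if no edge of $\mathcal{G}(B)$ goes from one of its nodes to a node of another component; otherwise it is transient. A class (an irreducible matrix) $B_i$ is unicyclic if $\mathcal{G}(B_i)$ consists of a single Hamiltonian cycle (a nonzero $1\times 1$ block being included), and multicyclic otherwise. The maximum over an empty set is taken to be $0$. *)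

theory Defs
  imports "HOL-Analysis.Analysis" "Graph_Theory.Digraph_Component"
begin

definition nonneg_matrix :: "real^'n^'n \<Rightarrow> bool" where
  "nonneg_matrix B \<longleftrightarrow> (\<forall>i j. 0 \<le> B $ i $ j)"

definition modulus_matrix :: "complex^'n^'n \<Rightarrow> real^'n^'n" where
  "modulus_matrix A = (\<chi> i j. cmod (A $ i $ j))"

definition Aux :: "real^'n^'n \<Rightarrow> real^'n^'n" where
  "Aux A = (\<chi> i j. if A $ i $ j \<noteq> 0 then (\<Sum>k\<in>UNIV. A $ i $ k) else 0)"

definition row_uniform :: "real^'n^'n \<Rightarrow> bool" where
  "row_uniform B \<longleftrightarrow>
     (\<forall>i j k. B $ i $ j \<noteq> 0 \<longrightarrow> B $ i $ k \<noteq> 0 \<longrightarrow> B $ i $ j = B $ i $ k)"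

definition aux_spectrum :: "real^'n^'n \<Rightarrow> complex set" where
  "aux_spectrum B =
     {l. \<exists>A :: complex^'n^'n. Aux (modulus_matrix A) = B \<and> det (A - mat l) = 0}"

text \<open>
  Principal submatrices of \<open>B\<close> have varying sizes, so the principal submatrix on the index
  set \<open>S\<close> is encoded by the pair \<open>B\<close>, \<open>S\<close>: the functions below take both
  arguments and only look at the entries of \<open>B\<close> with both indices in \<open>S\<close>.
  The whole matrix corresponds to \<open>S = UNIV\<close>.
\<close>

definition matrix_digraph :: "real^'n^'n \<Rightarrow> 'n set \<Rightarrow> ('n, 'n \<times> 'n) pre_digraph" where
  "matrix_digraph B S =
     \<lparr>verts = S, arcs = {(i, j). i \<in> S \<and> j \<in> S \<and> B $ i $ j \<noteq> 0}, tail = fst, head = snd\<rparr>"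

definition cycle_mean :: "real^'n^'n \<Rightarrow> ('n \<times> 'n) list \<Rightarrow> real" where
  "cycle_mean B p = root (length p) (\<Prod>(i, j)\<leftarrow>p. B $ i $ j)"

text \<open>
  In the library, a cycle is a nonempty closed walk, given by its list of arcs, that does not
  repeat a node (loops are cycles of length one). In particular there are finitely many.
\<close>

definition cycle_means :: "real^'n^'n \<Rightarrow> 'n set \<Rightarrow> real set" where
  "cycle_means B S = {cycle_mean B p | p. pre_digraph.cycle (matrix_digraph B S) p}"

definition Max0 :: "real set \<Rightarrow> real" where
  "Max0 X = (if X = {} then 0 else Max X)"

definition Min0 :: "real set \<Rightarrow> real" where
  "Min0 X = (if X = {} then 0 else Min X)"

definition mu :: "real^'n^'n \<Rightarrow> 'n set \<Rightarrow> real" where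
  "mu B S = Max0 (cycle_means B S)"

definition nu :: "real^'n^'n \<Rightarrow> 'n set \<Rightarrow> real" where
  "nu B S = Min0 (cycle_means B S)"

definition classes :: "real^'n^'n \<Rightarrow> 'n set set" where
  "classes B = pre_digraph.sccs_verts (matrix_digraph B UNIV)"

definition final_class :: "real^'n^'n \<Rightarrow> 'n set \<Rightarrow> bool" where
  "final_class B S \<longleftrightarrow> S \<in> classes B \<and>
     \<not> (\<exists>T\<in>classes B. T \<noteq> S \<and> (\<exists>i\<in>S. \<exists>j\<in>T. (i, j) \<in> arcs (matrix_digraph B UNIV)))"

definition transient_class :: "real^'n^'n \<Rightarrow> 'n set \<Rightarrow> bool" where
  "transient_class B S \<longleftrightarrow> S \<in> classes B \<and> \<not> final_class B S"

text \<open>The digraph consists of a single cycle: one cycle through all nodes uses all the arcs.\<close>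

definition unicyclic :: "real^'n^'n \<Rightarrow> 'n set \<Rightarrow> bool" where
  "unicyclic B S \<longleftrightarrow>
     (let G = matrix_digraph B S in
        \<exists>p. pre_digraph.cycle G p \<and> tail G ` set p = verts G \<and> set p = arcs G)"

text \<open>
  A zero class of size one has no cycle and is therefore multicyclic by this convention;
  it has \<^term>\<open>mu B S = 0\<close>.
\<close>

definition multicyclic :: "real^'n^'n \<Rightarrow> 'n set \<Rightarrow> bool" where
  "multicyclic B S \<longleftrightarrow> \<not> unicyclic B S"

definition M_tilde :: "real^'n^'n \<Rightarrow> real" where
  "M_tilde B =
     Max0 {mu B S | S. transient_class B S \<or> (final_class B S \<and> multicyclic B S)}"

end

(* The rows of A can be chosen independently, so a vector can be made an eigenvector row by row.
   A nonzero y >= 0 is an eigenvector for |s| of some real A (and A s/|s| has eigenvalue s) if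
   every row i satisfies one of: y vanishes at i and all its successors; |s| y_i = b_ij y_j for
   all successors j; or i has two successors, y_i > 0 and |s| y_i < b_ij y_j for some j.
   Given a cycle of mean larger than |s| through a node with two successors, such a y is obtained
   along the cycle by shrinking at its branching nodes, and is then propagated backwards to all
   nodes having access to the cycle. For a final class all of whose cycle means equal |s|, y is the
   potential that turns every edge into an equality.
   Conversely, let y consist of the moduli of an eigenvector. Moving always to a successor where y
   is largest, one ends in a strongly connected set whose cycles have means at least |s|. If
   |s| >= M~(B), then these means equal |s|, hence y is constant on the successors of each node
   there, and the set is a final class with mu = nu = |s|. *)
theory Submission
  imports Defs
begin

section \<open>Walks, cycles and classes\<close>

text \<open>A closed walk that is no cycle repeats a node, so a nonempty closed walk can be cut out
  of it; both pieces are shorter and the product splits accordingly. Since \<open>P\<close> is an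
  arbitrary submonoid, bounds as well as exact values pass from cycles to closed walks.\<close>

lemma (in wf_digraph) closed_awalk_prod_mem:
  fixes f :: "'b \<Rightarrow> 'c::comm_monoid_mult"
  assumes "awalk u p u"
    and cyc: "\<And>c. cycle c \<Longrightarrow> set c \<subseteq> set p \<Longrightarrow> prod_list (map f c) \<in> P"
    and one: "1 \<in> P" and mult: "\<And>x y. x \<in> P \<Longrightarrow> y \<in> P \<Longrightarrow> x * y \<in> P"
  shows "prod_list (map f p) \<in> P"
  using assms(1) cyc
proof (induction "length p" arbitrary: u p rule: less_induct)
  case less
  show ?case
  proof (cases p)
    case Nil
    then show ?thesis using one by simp
  next
    case (Cons e es)
    show ?thesis
    proof (cases "distinct (awalk_verts (head G e) es)")
      case True
      then have "cycle p"
        using less.prems(1) Cons unfolding cycle_def by auto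
      then show ?thesis using less.prems(2) by blast
    next
      case False
      have es: "awalk (head G e) es u" and e: "e \<in> arcs G" "tail G e = u"
        using less.prems(1) Cons by (auto simp: awalk_Cons_iff)
      obtain q r s w where dec: "es = q @ r @ s" "awalk (head G e) q w" "awalk w r w" "awalk w s u"
        "closed_w r"
        using awalk_cyc_decompE'[OF es False] by metis
      have "r \<noteq> []" using dec(5) by (auto simp: closed_w_def)
      have 1: "prod_list (map f r) \<in> P"
        using less.hyps[of r w] less.prems(2) dec Cons by auto
      have "awalk u ((e # q) @ s) u"
        using dec e by (auto simp: awalk_Cons_iff)
      then have 2: "prod_list (map f ((e # q) @ s)) \<in> P"
        using less.hyps[of "(e # q) @ s" u] less.prems(2) dec(1) Cons \<open>r \<noteq> []\<close>
        by (auto)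
      have "prod_list (map f p) = prod_list (map f r) * prod_list (map f ((e # q) @ s))"
        using Cons dec(1) by (simp add: ac_simps)
      then show ?thesis using mult[OF 1 2] by simp
    qed
  qed
qed

definition edges :: "real^'n^'n \<Rightarrow> ('n \<times> 'n) set" where
  "edges B = {(i, j). B $ i $ j \<noteq> 0}"

text \<open>Dividing each weight by \<open>r\<close> turns the comparison of a cycle mean with
  \<open>r\<close> into the comparison of a product with 1, and such products are multiplicative
  under concatenation.\<close>

definition rel_weight :: "real^'n^'n \<Rightarrow> real \<Rightarrow> ('n \<times> 'n) list \<Rightarrow> real" where
  "rel_weight B r p = (\<Prod>(i, j)\<leftarrow>p. B $ i $ j / r)"

lemma edges_iff [simp]: "(i, j) \<in> edges B \<longleftrightarrow> B $ i $ j \<noteq> 0"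
  by (simp add: edges_def)

lemma matrix_digraph_simps [simp]:
  "verts (matrix_digraph B S) = S" "tail (matrix_digraph B S) = fst" "head (matrix_digraph B S) = snd"
  "arcs (matrix_digraph B S) = edges B \<inter> S \<times> S"
  by (auto simp: matrix_digraph_def)

lemma wf_matrix_digraph: "wf_digraph (matrix_digraph B S)"
  by unfold_locales auto

abbreviation walk_in :: "real^'n^'n \<Rightarrow> 'n set \<Rightarrow> 'n \<Rightarrow> ('n \<times> 'n) list \<Rightarrow> 'n \<Rightarrow> bool" where
  "walk_in B S \<equiv> pre_digraph.awalk (matrix_digraph B S)"

abbreviation cycle_in :: "real^'n^'n \<Rightarrow> 'n set \<Rightarrow> ('n \<times> 'n) list \<Rightarrow> bool" where
  "cycle_in B S \<equiv> pre_digraph.cycle (matrix_digraph B S)"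

lemma walk_in_Nil [simp]: "walk_in B S u [] v \<longleftrightarrow> u = v \<and> u \<in> S"
  by (auto simp: wf_digraph.awalk_Nil_iff[OF wf_matrix_digraph])

lemma walk_in_Cons [simp]:
  "walk_in B S u (e # p) v \<longleftrightarrow> e \<in> edges B \<and> e \<in> S \<times> S \<and> fst e = u \<and> walk_in B S (snd e) p v"
  by (auto simp: wf_digraph.awalk_Cons_iff[OF wf_matrix_digraph])

lemma walk_in_append:
  "walk_in B S u p v \<Longrightarrow> walk_in B S v q w \<Longrightarrow> walk_in B S u (p @ q) w"
  by (induction p arbitrary: u) auto

lemma walk_in_arcs: "walk_in B S u p v \<Longrightarrow> set p \<subseteq> edges B \<inter> S \<times> S"
  by (simp add: pre_digraph.awalk_def)

lemma walk_in_verts: "walk_in B S u p v \<Longrightarrow> map fst p @ [v] = u # map snd p"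
  by (induction p arbitrary: u) auto

text \<open>Every inner node is the head of one arc and the tail of the next. The form without
  quotients also covers functions with zeros.\<close>

lemma walk_in_telescope:
  fixes y :: "'n::finite \<Rightarrow> real"
  assumes "walk_in B S u p v"
  shows "(\<Prod>e\<leftarrow>p. y (fst e)) * y v = y u * (\<Prod>e\<leftarrow>p. y (snd e))"
  using assms by (induction p arbitrary: u) auto

text \<open>The separate relation \<open>R\<close> allows the walk to be confined to selected arcs
  and not only to \<open>S\<close>.\<close>

lemma rtrancl_imp_walk_in:
  assumes "(u, v) \<in> R\<^sup>*" "R \<subseteq> edges B \<inter> S \<times> S" "v \<in> S"
  obtains p where "walk_in B S u p v" "set p \<subseteq> R"
proof -
  from assms have "\<exists>p. walk_in B S u p v \<and> set p \<subseteq> R"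
  proof (induction rule: converse_rtrancl_induct)
    case base
    have "walk_in B S v [] v \<and> set [] \<subseteq> R" using assms(3) by simp
    then show ?case ..
  next
    case (step x z)
    then obtain p where "walk_in B S z p v" "set p \<subseteq> R" by auto
    then have "walk_in B S x ((x, z) # p) v \<and> set ((x, z) # p) \<subseteq> R"
      using step by auto
    then show ?case ..
  qed
  then show ?thesis using that by blast
qed

lemma cycle_inD:
  assumes "cycle_in B S p"
  shows "p \<noteq> []" "\<exists>u. walk_in B S u p u" "distinct (map fst p)" "set p \<subseteq> edges B \<inter> S \<times> S"
    "fst ` set p = snd ` set p"
proof -
  obtain u where u: "walk_in B S u p u" "distinct (tl (pre_digraph.awalk_verts (matrix_digraph B S) u p))"
    and ne: "p \<noteq> []"
    using assms unfolding pre_digraph.cycle_def by auto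
  have "pre_digraph.cas (matrix_digraph B S) u p u"
    using u(1) by (simp add: pre_digraph.awalk_def)
  from pre_digraph.awalk_verts_conv'[OF this] u(2) ne have "distinct (map snd p)" by simp
  \<comment> \<open>On a closed walk the tails and the heads form the same multiset, so distinctness
    passes from the heads to the tails.\<close>
  moreover have "mset (map fst p @ [u]) = mset (u # map snd p)"
    by (simp only: walk_in_verts[OF u(1)])
  then have m: "mset (map fst p) = mset (map snd p)" by simp
  ultimately show "distinct (map fst p)" using mset_eq_imp_distinct_iff by blast
  show "fst ` set p = snd ` set p" using mset_eq_setD[OF m] by simp
  show "p \<noteq> []" "\<exists>u. walk_in B S u p u" "set p \<subseteq> edges B \<inter> S \<times> S"
    using u ne walk_in_arcs by blast+
qed

lemma cycle_in_exists:
  assumes "walk_in B S u p u" "p \<noteq> []"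
  obtains c where "cycle_in B S c"
  using wf_digraph.closed_w_imp_cycle[OF wf_matrix_digraph, of B S p] assms
  by (auto simp: wf_digraph.closed_w_def[OF wf_matrix_digraph])

lemma closed_walk_in_prod_mem:
  fixes f :: "'n::finite \<times> 'n \<Rightarrow> real"
  assumes "walk_in B S u p u"
    and "\<And>c. cycle_in B S c \<Longrightarrow> prod_list (map f c) \<in> P"
    and "1 \<in> P" and "\<And>x y. x \<in> P \<Longrightarrow> y \<in> P \<Longrightarrow> x * y \<in> P"
  shows "prod_list (map f p) \<in> P"
  using wf_digraph.closed_awalk_prod_mem[OF wf_matrix_digraph assms(1), of f P] assms(2-) by blast

section \<open>Extremal cycle means and their attainment\<close>

lemma Max0_ge: "finite X \<Longrightarrow> x \<in> X \<Longrightarrow> x \<le> Max0 X"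
  unfolding Max0_def using Max_ge by (metis empty_iff)

text \<open>A nonzero value cannot be the default for the empty set, so it is a genuine
  maximum.\<close>

lemma Max0_in: "finite X \<Longrightarrow> Max0 X \<noteq> 0 \<Longrightarrow> Max0 X \<in> X"
  using Max_in[of X] by (auto simp: Max0_def split: if_splits)

lemma finite_cycle_means [simp]: "finite (cycle_means B S)"
proof -
  have "{p. cycle_in B S p} \<subseteq> {p. set p \<subseteq> UNIV \<and> distinct p}"
    using cycle_inD(3) by (auto simp: distinct_map)
  then have "finite {p. cycle_in B S p}"
    by (rule finite_subset) (rule finite_subset_distinct, simp)
  moreover have "cycle_means B S = cycle_mean B ` {p. cycle_in B S p}"
    unfolding cycle_means_def by blast
  ultimately show ?thesis by simp
qed

lemma cycle_mean_le_mu: "cycle_in B S p \<Longrightarrow> cycle_mean B p \<le> mu B S"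
  unfolding mu_def by (rule Max0_ge) (simp, unfold cycle_means_def, blast)

lemma nu_le_cycle_mean:
  assumes "cycle_in B S p" shows "nu B S \<le> cycle_mean B p"
proof -
  have "cycle_mean B p \<in> cycle_means B S" using assms unfolding cycle_means_def by blast
  then show ?thesis unfolding nu_def Min0_def
    using Min_le[OF finite_cycle_means] by (metis empty_iff)
qed

lemma mu_attained:
  assumes "mu B S \<noteq> 0"
  obtains p where "cycle_in B S p" "cycle_mean B p = mu B S"
proof -
  have "mu B S \<in> cycle_means B S" using assms Max0_in by (simp add: mu_def)
  then obtain p where "mu B S = cycle_mean B p" "cycle_in B S p"
    unfolding cycle_means_def by blast
  then show ?thesis by (intro that) simp_all
qed

text \<open>The cycle \<open>c\<close> makes the set of means nonempty, so that neither value is the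
  default 0.\<close>

lemma mu_nu_eqI:
  assumes "cycle_in B S c" and "\<And>p. cycle_in B S p \<Longrightarrow> cycle_mean B p = r"
  shows "mu B S = r" "nu B S = r"
proof -
  have "cycle_means B S = {r}" using assms unfolding cycle_means_def by blast
  then show "mu B S = r" "nu B S = r" by (simp_all add: mu_def nu_def Max0_def Min0_def)
qed

lemma le_M_tilde:
  assumes "transient_class B S \<or> final_class B S \<and> multicyclic B S"
  shows "mu B S \<le> M_tilde B"
  unfolding M_tilde_def
proof (rule Max0_ge)
  show "mu B S \<in> {mu B S | S. transient_class B S \<or> final_class B S \<and> multicyclic B S}"
    using assms by (intro CollectI exI[of _ S] conjI refl)
qed (rule finite_subset[of _ "mu B ` UNIV"], auto)

lemma M_tilde_attained:
  assumes "M_tilde B \<noteq> 0"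
  obtains S where "transient_class B S \<or> final_class B S \<and> multicyclic B S" "mu B S = M_tilde B"
proof -
  have "M_tilde B \<in> {mu B S | S. transient_class B S \<or> final_class B S \<and> multicyclic B S}"
    using assms unfolding M_tilde_def
    by (intro Max0_in) (rule finite_subset[of _ "mu B ` UNIV"], auto)
  then obtain S where "M_tilde B = mu B S" "transient_class B S \<or> final_class B S \<and> multicyclic B S"
    unfolding mem_Collect_eq by (elim exE conjE)
  then show ?thesis by (intro that) simp_all
qed

section \<open>Classes as components of mutual reachability\<close>

lemma reachable_matrix_digraph: "u \<rightarrow>\<^sup>*\<^bsub>matrix_digraph B UNIV\<^esub> v \<longleftrightarrow> (u, v) \<in> (edges B)\<^sup>*"
proof -
  have "arcs_ends (matrix_digraph B UNIV) = edges B"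
    by (auto simp: arcs_ends_def arc_to_ends_def)
  then show ?thesis
    by (simp add: wf_digraph.reachable_conv[OF wf_matrix_digraph])
qed

lemma classes_iff:
  "S \<in> classes B \<longleftrightarrow> S \<noteq> {} \<and> (\<forall>u\<in>S. \<forall>v\<in>S. (u, v) \<in> (edges B)\<^sup>*) \<and>
     (\<forall>u\<in>S. \<forall>v. (u, v) \<in> (edges B)\<^sup>* \<longrightarrow> (v, u) \<in> (edges B)\<^sup>* \<longrightarrow> v \<in> S)"
  unfolding classes_def pre_digraph.sccs_verts_def reachable_matrix_digraph by blast

lemma class_reachable: "S \<in> classes B \<Longrightarrow> u \<in> S \<Longrightarrow> v \<in> S \<Longrightarrow> (u, v) \<in> (edges B)\<^sup>*"
  by (drule classes_iff[THEN iffD1]) (elim conjE, drule bspec, assumption, erule bspec)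

lemma class_closed:
  "S \<in> classes B \<Longrightarrow> u \<in> S \<Longrightarrow> (u, v) \<in> (edges B)\<^sup>* \<Longrightarrow> (v, u) \<in> (edges B)\<^sup>* \<Longrightarrow> v \<in> S"
  by (drule classes_iff[THEN iffD1]) (elim conjE, rotate_tac -1, drule bspec, assumption, erule allE, erule (1) impE, erule (1) impE, assumption)

lemma class_exists: obtains S where "S \<in> classes B" "i \<in> S"
proof
  let ?S = "{j. (i, j) \<in> (edges B)\<^sup>* \<and> (j, i) \<in> (edges B)\<^sup>*}"
  show i: "i \<in> ?S" by simp
  show "?S \<in> classes B"
    unfolding classes_iff
  proof (intro conjI ballI allI impI)
    show "?S \<noteq> {}" using i by blast
  qed (auto elim: rtrancl_trans)
qed

lemma class_eqI:
  assumes "S \<in> classes B" "T \<in> classes B" "i \<in> S" "i \<in> T" shows "S = T"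
proof -
  have "x \<in> V" if "U \<in> classes B" "i \<in> U" "V \<in> classes B" "i \<in> V" "x \<in> U" for U V x
    by (rule class_closed[OF that(3,4)]; rule class_reachable[OF that(1)]; fact that)
  then show ?thesis using assms by (intro set_eqI iffI)
qed

text \<open>The classes partition the nodes, so an edge leaving \<open>S\<close> is the same as an
  edge into another class. Finality thereby becomes closedness under successors.\<close>

lemma final_class_iff:
  "final_class B S \<longleftrightarrow> S \<in> classes B \<and> (\<forall>i\<in>S. \<forall>j. B $ i $ j \<noteq> 0 \<longrightarrow> j \<in> S)"
proof (cases "S \<in> classes B")
  case S: True
  have 1: "j \<notin> S" if "T \<in> classes B" "T \<noteq> S" "j \<in> T" for T j
    using class_eqI[OF S that(1) _ that(3)] that(2) by blast
  have 2: "\<exists>T\<in>classes B. T \<noteq> S \<and> j \<in> T" if "j \<notin> S" for j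
    using class_exists[of B j] that by metis
  have "(\<exists>T\<in>classes B. T \<noteq> S \<and> (\<exists>i\<in>S. \<exists>j\<in>T. B $ i $ j \<noteq> 0)) \<longleftrightarrow>
      \<not> (\<forall>i\<in>S. \<forall>j. B $ i $ j \<noteq> 0 \<longrightarrow> j \<in> S)" (is "?L \<longleftrightarrow> \<not> ?R")
  proof
    assume ?L
    then obtain T i j where "T \<in> classes B" "T \<noteq> S" "i \<in> S" "j \<in> T" "B $ i $ j \<noteq> 0" by blast
    with 1[of T j] show "\<not> ?R" by blast
  next
    assume "\<not> ?R"
    then obtain i j where "i \<in> S" "B $ i $ j \<noteq> 0" "j \<notin> S" by blast
    moreover obtain T where "T \<in> classes B" "T \<noteq> S" "j \<in> T" using 2[OF \<open>j \<notin> S\<close>] by blast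
    ultimately show ?L by blast
  qed
  moreover have "(i, j) \<in> arcs (matrix_digraph B UNIV) \<longleftrightarrow> B $ i $ j \<noteq> 0" for i j
    by simp
  ultimately show ?thesis using S unfolding final_class_def by (simp only: simp_thms)
qed (simp add: final_class_def)

text \<open>A path between two nodes of \<open>S\<close> cannot leave \<open>S\<close>: each node on
  it is reachable from \<open>S\<close> and reaches \<open>S\<close> again.\<close>

lemma class_walk_in:
  assumes S: "S \<in> classes B" and "u \<in> S" "v \<in> S"
  obtains p where "walk_in B S u p v"
proof -
  have "(u, v) \<in> (edges B)\<^sup>*" by (rule class_reachable[OF assms])
  from this \<open>u \<in> S\<close> have "(u, v) \<in> (edges B \<inter> S \<times> S)\<^sup>*"
  proof (induction rule: converse_rtrancl_induct)
    case base
    show ?case by (rule rtrancl_refl)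
  next
    case (step x z)
    have "(v, x) \<in> (edges B)\<^sup>*" by (rule class_reachable[OF S \<open>v \<in> S\<close> step.prems])
    with step.hyps(2) have "(z, x) \<in> (edges B)\<^sup>*" by (rule rtrancl_trans)
    then have z: "z \<in> S" by (rule class_closed[OF S step.prems r_into_rtrancl[OF step.hyps(1)]])
    then have "(x, z) \<in> edges B \<inter> S \<times> S" using step.hyps(1) step.prems by blast
    then show ?case by (rule converse_rtrancl_into_rtrancl) (rule step.IH[OF z])
  qed
  then show ?thesis
    using rtrancl_imp_walk_in[of u v "edges B \<inter> S \<times> S" B S thesis] that \<open>v \<in> S\<close> by blast
qed

section \<open>Eigenvectors and their moduli\<close>

lemma nonneg_matrix_pos: "nonneg_matrix B \<Longrightarrow> B $ i $ j \<noteq> 0 \<Longrightarrow> 0 < B $ i $ j"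
  by (simp add: nonneg_matrix_def less_le)

section \<open>Weights relative to a radius\<close>

lemma rel_weight_Nil [simp]: "rel_weight B r [] = 1"
  and rel_weight_Cons [simp]: "rel_weight B r (e # p) = B $ fst e $ snd e / r * rel_weight B r p"
  and rel_weight_append: "rel_weight B r (p @ q) = rel_weight B r p * rel_weight B r q"
  by (simp_all add: rel_weight_def case_prod_beta)

lemma rel_weight_conv: "rel_weight B r p = (\<Prod>(i, j)\<leftarrow>p. B $ i $ j) / r ^ length p"
  by (induction p) (auto simp: field_simps)

lemma rel_weight_nonneg: "nonneg_matrix B \<Longrightarrow> 0 < r \<Longrightarrow> 0 \<le> rel_weight B r p"
  by (induction p) (auto simp: nonneg_matrix_def)

lemma rel_weight_pos:
  assumes "nonneg_matrix B" "0 < r" "set p \<subseteq> edges B" shows "0 < rel_weight B r p"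
proof -
  have "0 < B $ i $ j" if "(i, j) \<in> edges B" for i j
    using that nonneg_matrix_pos[OF assms(1)] by simp
  then show ?thesis using assms(2,3) by (induction p) auto
qed

text \<open>Writing \<open>r\<close> as the root of its own power reduces both comparisons to
  monotonicity of the root.\<close>

lemma cycle_mean_compare:
  assumes B: "nonneg_matrix B" and c: "cycle_in B S p" and r: "0 < r"
  shows "cycle_mean B p \<le> r \<longleftrightarrow> rel_weight B r p \<le> 1"
    and "r \<le> cycle_mean B p \<longleftrightarrow> 1 \<le> rel_weight B r p"
proof -
  let ?X = "\<Prod>(i, j)\<leftarrow>p. B $ i $ j" and ?n = "length p"
  have n: "0 < ?n" using cycle_inD(1)[OF c] by simp
  have r': "r = root ?n (r ^ ?n)" using n r by (simp add: real_root_power_cancel)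
  have "root ?n ?X \<le> r \<longleftrightarrow> ?X \<le> r ^ ?n" "r \<le> root ?n ?X \<longleftrightarrow> r ^ ?n \<le> ?X"
    using n by (subst r', simp)+
  then show "cycle_mean B p \<le> r \<longleftrightarrow> rel_weight B r p \<le> 1"
    "r \<le> cycle_mean B p \<longleftrightarrow> 1 \<le> rel_weight B r p"
    using r by (simp_all add: cycle_mean_def rel_weight_conv field_simps)
qed

lemma cycle_mean_pos:
  assumes B: "nonneg_matrix B" and c: "cycle_in B S p" shows "0 < cycle_mean B p"
proof -
  have "0 < rel_weight B 1 p"
    using rel_weight_pos[OF B, of 1 p] cycle_inD(4)[OF c] by auto
  then show ?thesis using cycle_inD(1)[OF c]
    by (simp add: cycle_mean_def rel_weight_conv)
qed

lemma closed_walk_rel_weight_le_1: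
  assumes B: "nonneg_matrix B" and r: "0 < r" and p: "walk_in B S u p u"
    and c: "\<And>c. cycle_in B S c \<Longrightarrow> cycle_mean B c \<le> r"
  shows "rel_weight B r p \<le> 1"
proof -
  \<comment> \<open>The lower end 0 is included in the claim because the numbers up to 1 are closed
    under multiplication only when they are nonnegative.\<close>
  have "prod_list (map (\<lambda>(i, j). B $ i $ j / r) p) \<in> {0..1}"
  proof (rule closed_walk_in_prod_mem[OF p])
    fix c assume "cycle_in B S c"
    then show "prod_list (map (\<lambda>(i, j). B $ i $ j / r) c) \<in> {0..1}"
      using c cycle_mean_compare(1)[OF B _ r] rel_weight_nonneg[OF B r, of c] 
      unfolding rel_weight_def by auto
  qed (auto simp: mult_le_one)
  then show ?thesis by (simp add: rel_weight_def)
qed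

lemma closed_walk_rel_weight_eq_1:
  assumes B: "nonneg_matrix B" and r: "0 < r" and p: "walk_in B S u p u"
    and c: "\<And>c. cycle_in B S c \<Longrightarrow> cycle_mean B c = r"
  shows "rel_weight B r p = 1"
proof -
  have "prod_list (map (\<lambda>(i, j). B $ i $ j / r) p) \<in> {1}"
  proof (rule closed_walk_in_prod_mem[OF p])
    fix c' assume c': "cycle_in B S c'"
    then have "rel_weight B r c' = 1"
      using c[OF c'] cycle_mean_compare[OF B c' r] by simp
    then show "prod_list (map (\<lambda>(i, j). B $ i $ j / r) c') \<in> {1}"
      unfolding rel_weight_def by simp
  qed auto
  then show ?thesis by (simp add: rel_weight_def)
qed

section \<open>Rows with a prescribed action on a nonnegative vector\<close>

definition branching :: "real^'n^'n \<Rightarrow> 'n \<Rightarrow> bool" where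
  "branching B i \<longleftrightarrow> (\<exists>j k. j \<noteq> k \<and> B $ i $ j \<noteq> 0 \<and> B $ i $ k \<noteq> 0)"

text \<open>The second alternative asks for a successor because its equations hold vacuously on a
  zero row. In the third, a node \<open>j\<close> satisfying the strict inequality is automatically
  a successor when \<open>r\<close> is positive and \<open>y\<close> is nonnegative.\<close>

definition admissible :: "real^'n^'n \<Rightarrow> real \<Rightarrow> ('n \<Rightarrow> real) \<Rightarrow> 'n \<Rightarrow> bool" where
  "admissible B r y i \<longleftrightarrow>
     y i = 0 \<and> (\<forall>j. B $ i $ j \<noteq> 0 \<longrightarrow> y j = 0) \<or>
     (\<exists>j. B $ i $ j \<noteq> 0) \<and> (\<forall>j. B $ i $ j \<noteq> 0 \<longrightarrow> r * y i = B $ i $ j * y j) \<or>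
     0 < y i \<and> branching B i \<and> (\<exists>j. r * y i < B $ i $ j * y j)"

text \<open>Row uniformity leaves one constraint besides the zero pattern: the moduli of the row sum
  to the common value \<open>b\<close>. Equal weights settle the case of equalities. In the strict
  case most weight could go to one successor, giving too large a value; shifting part of it to the
  others with negative sign lowers the value continuously to the required one.\<close>

lemma admissible_row_exists:
  fixes B :: "real^'n^'n"
  assumes B: "nonneg_matrix B" "row_uniform B" and r: "0 < r" and y: "\<And>j. 0 \<le> y j"
    and ad: "admissible B r y i"
  shows "\<exists>a. (\<forall>j. a j = 0 \<longleftrightarrow> B $ i $ j = 0) \<and>
    (\<forall>j. B $ i $ j \<noteq> 0 \<longrightarrow> (\<Sum>k\<in>UNIV. \<bar>a k\<bar>) = B $ i $ j) \<and> (\<Sum>j\<in>UNIV. a j * y j) = r * y i"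
proof -
  define E where "E = {j. B $ i $ j \<noteq> 0}"
  have fin: "finite E" by simp
  show ?thesis
  proof (cases "E = {}")
    case True
    then have "y i = 0" using ad y[of i] r by (auto simp: admissible_def E_def branching_def)
    then show ?thesis using True by (intro exI[of _ "\<lambda>_. 0"]) (auto simp: E_def)
  next
    case False
    then obtain j\<^sub>1 where j1: "j\<^sub>1 \<in> E" by blast
    define b where "b = B $ i $ j\<^sub>1"
    have b: "B $ i $ j = b" if "j \<in> E" for j
    proof -
      have "B $ i $ j \<noteq> 0" "B $ i $ j\<^sub>1 \<noteq> 0" using that j1 by (simp_all add: E_def)
      then show ?thesis using B(2) unfolding row_uniform_def b_def by metis
    qed
    have bpos: "0 < b" using j1 nonneg_matrix_pos[OF B(1)] by (simp add: b_def E_def)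
    have Ene: "E \<noteq> {}" using j1 by blast
    show ?thesis
    proof (cases "0 < y i \<and> branching B i \<and> (\<exists>j. r * y i < B $ i $ j * y j)")
      case False
      \<comment> \<open>The remaining alternatives both give
        \<open>r * y i = B $ i $ j * y j\<close> for every successor, so any weighted mean has the
        right value and the uniform one is taken.\<close>
      define a where "a j = B $ i $ j / card E" for j
      have a_out: "a j = 0 \<longleftrightarrow> j \<notin> E" for j
      proof -
        have "a j = 0 \<longleftrightarrow> B $ i $ j = 0" using Ene unfolding a_def by simp
        then show ?thesis by (simp add: E_def)
      qed
      have "(\<Sum>k\<in>UNIV. \<bar>a k\<bar>) = (\<Sum>k\<in>E. b / card E)"
      proof (rule sum.mono_neutral_cong_right)
        show "\<bar>a k\<bar> = b / card E" if "k \<in> E" for k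
          unfolding a_def b[OF that] using bpos by simp
      qed (simp_all add: a_out)
      then have s1: "(\<Sum>k\<in>UNIV. \<bar>a k\<bar>) = b" using Ene by simp
      have "(\<Sum>j\<in>UNIV. a j * y j) = (\<Sum>j\<in>E. r * y i / card E)"
      proof (rule sum.mono_neutral_cong_right)
        show "a j * y j = r * y i / card E" if "j \<in> E" for j
        proof -
          have "B $ i $ j * y j = r * y i"
            using ad False that by (auto simp: admissible_def E_def)
          then show ?thesis by (simp add: a_def)
        qed
      qed (simp_all add: a_out)
      then have s2: "(\<Sum>j\<in>UNIV. a j * y j) = r * y i" using Ene by simp
      show ?thesis
      proof (intro exI[of _ a] conjI allI impI)
        show "a j = 0 \<longleftrightarrow> B $ i $ j = 0" for j using a_out[of j] by (simp add: E_def)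
        show "(\<Sum>k\<in>UNIV. \<bar>a k\<bar>) = B $ i $ j" if "B $ i $ j \<noteq> 0" for j
          using that b[of j] s1 by (simp add: E_def)
      qed (rule s2)
    next
      case True
      then obtain j\<^sub>0 where j0: "r * y i < B $ i $ j\<^sub>0 * y j\<^sub>0" and br: "branching B i" and yi: "0 < y i"
        by blast
      have "B $ i $ j\<^sub>0 \<noteq> 0" using j0 r yi by (metis less_numeral_extra(3) mult_pos_pos mult_zero_left order_less_trans)
      then have j0E: "j\<^sub>0 \<in> E" by (simp add: E_def)
      define F where "F = E - {j\<^sub>0}"
      have Fne: "F \<noteq> {}" using br by (auto simp: F_def E_def branching_def)
      then have N: "0 < real (card F)" by (simp add: card_gt_0_iff)
      \<comment> \<open>After division by \<open>b\<close> the row must produce \<open>t\<close>.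
        All weight on \<open>j\<^sub>0\<close> would produce \<open>m\<close>, which exceeds
        \<open>t\<close>; all weight spread negatively over \<open>F\<close> would produce
        \<open>- s\<close>, which is below \<open>t\<close>.\<close>
      define m where "m = y j\<^sub>0"
      define t where "t = r * y i / b"
      define s where "s = (\<Sum>j\<in>F. y j) / card F"
      have t: "0 < t" "t < m" using j0 b[OF j0E] bpos yi r by (auto simp: t_def m_def field_simps)
      have s: "0 \<le> s" using y by (auto simp: s_def intro!: divide_nonneg_nonneg sum_nonneg)
      \<comment> \<open>Weight \<open>1 - e\<close> goes to \<open>j\<^sub>0\<close>, the rest is spread with negative sign; \<open>e\<close> is tuned to hit \<open>t\<close>.\<close>
      define e where "e = (m - t) / (m + s)"
      have e: "0 < e" "e < 1" "e * (m + s) = m - t" using t s by (auto simp: e_def field_simps)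
      define a where "a j = (if j = j\<^sub>0 then b * (1 - e) else if j \<in> E then - (b * e / card F) else 0)" for j
      have a_out: "a j = 0 \<longleftrightarrow> j \<notin> E" for j using e bpos N j0E by (auto simp: a_def)
      have split: "(\<Sum>j\<in>UNIV. g j) = g j\<^sub>0 + (\<Sum>j\<in>F. g j)" if "\<And>j. j \<notin> E \<Longrightarrow> g j = 0" for g :: "'n \<Rightarrow> real"
      proof -
        have "(\<Sum>j\<in>UNIV. g j) = (\<Sum>j\<in>E. g j)"
          using that by (intro sum.mono_neutral_right) auto
        also have "\<dots> = g j\<^sub>0 + (\<Sum>j\<in>F. g j)" unfolding F_def by (rule sum.remove[OF fin j0E])
        finally show ?thesis .
      qed
      have "(\<Sum>j\<in>F. \<bar>a j\<bar>) = (\<Sum>j\<in>F. b * e / card F)"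
        using e bpos N by (intro sum.cong refl) (auto simp: a_def F_def)
      then have "(\<Sum>j\<in>F. \<bar>a j\<bar>) = b * e" using Fne by simp
      moreover have "\<bar>a j\<^sub>0\<bar> = b * (1 - e)" using e bpos by (simp add: a_def)
      ultimately have s1: "(\<Sum>k\<in>UNIV. \<bar>a k\<bar>) = b"
        using split[of "\<lambda>j. \<bar>a j\<bar>"] a_out by (simp add: algebra_simps)
      have "(\<Sum>j\<in>F. a j * y j) = (\<Sum>j\<in>F. - (b * e / card F) * y j)"
        by (intro sum.cong refl) (auto simp: a_def F_def)
      also have "\<dots> = - (b * e / card F) * (\<Sum>j\<in>F. y j)" by (simp only: sum_distrib_left)
      also have "\<dots> = - (b * e * s)" by (simp add: s_def)
      finally have "(\<Sum>j\<in>UNIV. a j * y j) = b * (1 - e) * m - b * e * s"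
        using split[of "\<lambda>j. a j * y j"] a_out by (simp add: a_def m_def)
      also have "\<dots> = b * (m - e * (m + s))" by (simp add: algebra_simps)
      also have "\<dots> = r * y i" using bpos by (simp add: e(3) t_def)
      finally have s2: "(\<Sum>j\<in>UNIV. a j * y j) = r * y i" .
      show ?thesis
      proof (intro exI[of _ a] conjI allI impI)
        show "a j = 0 \<longleftrightarrow> B $ i $ j = 0" for j using a_out[of j] by (simp add: E_def)
        show "(\<Sum>k\<in>UNIV. \<bar>a k\<bar>) = B $ i $ j" if "B $ i $ j \<noteq> 0" for j
          using that b[of j] s1 by (simp add: E_def)
      qed (rule s2)
    qed
  qed
qed

section \<open>The spectrum in terms of eigenvectors\<close>

lemma det_eq_0_iff_kernel:
  fixes A :: "'a::field^'n^'n"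
  shows "det A = 0 \<longleftrightarrow> (\<exists>x. x \<noteq> 0 \<and> A *v x = 0)"
  using invertible_det_nz[of A] invertible_left_inverse[of A] matrix_left_invertible_ker[of A] by metis

text \<open>A nonzero entry makes its row sum of moduli nonzero, so passing to \<open>Aux\<close>
  preserves the zero pattern. The conditions that result concern each row separately.\<close>

lemma Aux_modulus_matrix_eq_iff:
  "Aux (modulus_matrix A) = B \<longleftrightarrow>
     (\<forall>i j. (A $ i $ j = 0 \<longleftrightarrow> B $ i $ j = 0) \<and> (B $ i $ j \<noteq> 0 \<longrightarrow> (\<Sum>k\<in>UNIV. cmod (A $ i $ k)) = B $ i $ j))"
proof -
  have ne: "(\<Sum>k\<in>UNIV. cmod (A $ i $ k)) \<noteq> 0" if "A $ i $ j \<noteq> 0" for i j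
    using that by (subst sum_nonneg_eq_0_iff) auto
  have entry: "Aux (modulus_matrix A) $ i $ j =
      (if A $ i $ j \<noteq> 0 then \<Sum>k\<in>UNIV. cmod (A $ i $ k) else 0)" for i j
    by (simp add: Aux_def modulus_matrix_def)
  have key: "Aux (modulus_matrix A) $ i $ j = B $ i $ j \<longleftrightarrow>
     (A $ i $ j = 0 \<longleftrightarrow> B $ i $ j = 0) \<and> (B $ i $ j \<noteq> 0 \<longrightarrow> (\<Sum>k\<in>UNIV. cmod (A $ i $ k)) = B $ i $ j)" for i j
    using ne[of i j] by (cases "A $ i $ j = 0") (auto simp: entry)
  show ?thesis by (simp only: vec_eq_iff key)
qed

lemma matrix_vector_minus_mat:
  fixes A :: "complex^'n^'n"
  shows "(A - mat s) *v x = 0 \<longleftrightarrow> (\<forall>i. (\<Sum>j\<in>UNIV. A $ i $ j * x $ j) = s * x $ i)"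
proof -
  have "(mat s *v x) $ i = s * x $ i" for i
  proof -
    have "(mat s *v x) $ i = (\<Sum>j\<in>UNIV. if i = j then s * x $ j else 0)"
      unfolding matrix_vector_mult_def mat_def by (simp add: if_distrib[of "\<lambda>z. z * _"] cong: if_cong)
    then show ?thesis by simp
  qed
  then show ?thesis
    by (simp add: matrix_vector_mult_diff_rdistrib vec_eq_iff) (simp add: matrix_vector_mult_def)
qed

lemma aux_spectrum_iff:
  "s \<in> aux_spectrum B \<longleftrightarrow> (\<exists>A x. Aux (modulus_matrix A) = B \<and> x \<noteq> 0 \<and>
     (\<forall>i. (\<Sum>j\<in>UNIV. A $ i $ j * x $ j) = s * x $ i))"
  unfolding aux_spectrum_def det_eq_0_iff_kernel matrix_vector_minus_mat by simp

text \<open>The rows chosen independently form a real matrix with eigenvector \<open>y\<close> and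
  eigenvalue \<open>cmod s\<close>. Multiplication by the unimodular number
  \<open>s / cmod s\<close> keeps all moduli and turns the eigenvalue into \<open>s\<close>.\<close>

lemma admissible_imp_aux_spectrum:
  fixes B :: "real^'n^'n"
  assumes B: "nonneg_matrix B" "row_uniform B" and s: "s \<noteq> 0" and y: "\<And>j. 0 \<le> y j" "y i\<^sub>0 \<noteq> 0"
    and ad: "\<And>i. admissible B (cmod s) y i"
  shows "s \<in> aux_spectrum B"
proof -
  let ?r = "cmod s"
  have r: "0 < ?r" using s by simp
  have "\<exists>a. \<forall>i. (\<forall>j. a i j = 0 \<longleftrightarrow> B $ i $ j = 0) \<and>
    (\<forall>j. B $ i $ j \<noteq> 0 \<longrightarrow> (\<Sum>k\<in>UNIV. \<bar>a i k\<bar>) = B $ i $ j) \<and> (\<Sum>j\<in>UNIV. a i j * y j) = ?r * y i"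
    by (intro choice allI admissible_row_exists B r y ad)
  then obtain a where a: "\<And>i j. a i j = 0 \<longleftrightarrow> B $ i $ j = 0"
    "\<And>i j. B $ i $ j \<noteq> 0 \<Longrightarrow> (\<Sum>k\<in>UNIV. \<bar>a i k\<bar>) = B $ i $ j"
    "\<And>i. (\<Sum>j\<in>UNIV. a i j * y j) = ?r * y i"
    by blast
  define A :: "complex^'n^'n" where "A = (\<chi> i j. s / ?r * a i j)"
  define x :: "complex^'n" where "x = (\<chi> j. complex_of_real (y j))"
  have cmodA: "cmod (A $ i $ j) = \<bar>a i j\<bar>" for i j
    using r by (simp add: A_def norm_mult norm_divide)
  have "A $ i $ j = 0 \<longleftrightarrow> B $ i $ j = 0" for i j
    using cmodA[of i j] a(1)[of i j] by (metis abs_eq_0 norm_eq_zero)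
  then have "Aux (modulus_matrix A) = B"
    unfolding Aux_modulus_matrix_eq_iff cmodA using a(2) by blast
  moreover have "x \<noteq> 0" using y(2) by (auto simp: x_def vec_eq_iff)
  moreover have "(\<Sum>j\<in>UNIV. A $ i $ j * x $ j) = s * x $ i" for i
  proof -
    have "(\<Sum>j\<in>UNIV. A $ i $ j * x $ j) = s / ?r * complex_of_real (\<Sum>j\<in>UNIV. a i j * y j)"
      by (simp add: A_def x_def sum_distrib_left mult.assoc)
    then show ?thesis using r s by (simp add: a(3) x_def)
  qed
  ultimately show ?thesis unfolding aux_spectrum_iff by (intro exI conjI allI)
qed

text \<open>The triangle inequality bounds \<open>cmod s * y i\<close> by a sum over the successors
  whose positive weights add up to the row value of \<open>B\<close>. Hence it is at most that value
  times the largest \<open>y j\<close>, with equality only if \<open>y\<close> is constant on the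
  successors. With a single successor the triangle inequality is an equality.\<close>

lemma aux_spectrum_moduli:
  fixes B :: "real^'n^'n"
  assumes s: "s \<in> aux_spectrum B" "s \<noteq> 0"
  obtains y where "\<forall>i. 0 \<le> y i" "\<exists>i. 0 < y i"
    "\<forall>i. 0 < y i \<longrightarrow> (\<exists>j. B $ i $ j \<noteq> 0)"
    "\<forall>i j. B $ i $ j \<noteq> 0 \<longrightarrow> (\<forall>k. B $ i $ k \<noteq> 0 \<longrightarrow> y k \<le> y j) \<longrightarrow> cmod s * y i \<le> B $ i $ j * y j"
    "\<forall>i j k. B $ i $ j \<noteq> 0 \<longrightarrow> (\<forall>k. B $ i $ k \<noteq> 0 \<longrightarrow> y k \<le> y j) \<longrightarrow>
       cmod s * y i = B $ i $ j * y j \<longrightarrow> B $ i $ k \<noteq> 0 \<longrightarrow> y k = y j"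
    "\<forall>i j. B $ i $ j \<noteq> 0 \<longrightarrow> \<not> branching B i \<longrightarrow> cmod s * y i = B $ i $ j * y j"
proof -
  let ?r = "cmod s"
  obtain A :: "complex^'n^'n" and x where A: "Aux (modulus_matrix A) = B" and x: "x \<noteq> 0"
    and eig: "\<And>i. (\<Sum>j\<in>UNIV. A $ i $ j * x $ j) = s * x $ i"
    using s(1) unfolding aux_spectrum_iff by blast
  define a where "a i j = cmod (A $ i $ j)" for i j
  define y where "y i = cmod (x $ i)" for i
  have a0: "a i j = 0 \<longleftrightarrow> B $ i $ j = 0" and asum: "B $ i $ j \<noteq> 0 \<Longrightarrow> (\<Sum>k\<in>UNIV. a i k) = B $ i $ j"
    and a_nonneg: "0 \<le> a i j" for i j
    using A unfolding Aux_modulus_matrix_eq_iff a_def by simp_all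
  have le: "?r * y i \<le> (\<Sum>j\<in>UNIV. a i j * y j)" for i
  proof -
    have "?r * y i = cmod (\<Sum>j\<in>UNIV. A $ i $ j * x $ j)" by (simp add: eig norm_mult y_def)
    also have "\<dots> \<le> (\<Sum>j\<in>UNIV. cmod (A $ i $ j * x $ j))" by (rule norm_sum)
    finally show ?thesis by (simp add: norm_mult a_def y_def)
  qed
  \<comment> \<open>The gap between the maximal value and the weighted sum is written as a sum that
    has nonnegative terms once \<open>y j\<close> is maximal; a vanishing gap then makes each term
    vanish.\<close>
  have max: "(\<Sum>k\<in>UNIV. a i k * (y j - y k)) = B $ i $ j * y j - (\<Sum>k\<in>UNIV. a i k * y k)"
    if "B $ i $ j \<noteq> 0" for i j
  proof -
    have "(\<Sum>k\<in>UNIV. a i k * (y j - y k)) = (\<Sum>k\<in>UNIV. a i k) * y j - (\<Sum>k\<in>UNIV. a i k * y k)"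
      by (simp add: right_diff_distrib sum_subtractf sum_distrib_right)
    then show ?thesis using asum[OF that] by simp
  qed
  have nn: "0 \<le> a i k * (y j - y k)" if "\<And>k. B $ i $ k \<noteq> 0 \<Longrightarrow> y k \<le> y j" for i j k
    using that a0[of i k] a_nonneg[of i k] by (cases "B $ i $ k = 0") auto
  show ?thesis
  proof (rule that; (intro allI impI)?)
    show "0 \<le> y i" for i by (simp add: y_def)
    show "\<exists>i. 0 < y i" using x by (auto simp: y_def vec_eq_iff)
    show "\<exists>j. B $ i $ j \<noteq> 0" if "0 < y i" for i
    proof (rule ccontr)
      assume "\<not> ?thesis"
      then have "a i j = 0" for j using a0 by blast
      then have "(\<Sum>j\<in>UNIV. a i j * y j) = 0" by simp
      then show False using le[of i] that s(2) by (simp add: mult_le_0_iff)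
    qed
  next
    fix i j assume ij: "B $ i $ j \<noteq> 0" and m: "\<forall>k. B $ i $ k \<noteq> 0 \<longrightarrow> y k \<le> y j"
    have "0 \<le> (\<Sum>k\<in>UNIV. a i k * (y j - y k))" by (rule sum_nonneg) (rule nn[OF m[rule_format]])
    then show "?r * y i \<le> B $ i $ j * y j" using le[of i] max[OF ij] by simp
  next
    fix i j k assume ij: "B $ i $ j \<noteq> 0" and m: "\<forall>k. B $ i $ k \<noteq> 0 \<longrightarrow> y k \<le> y j"
      and eq: "?r * y i = B $ i $ j * y j" and ik: "B $ i $ k \<noteq> 0"
    have "0 \<le> (\<Sum>k\<in>UNIV. a i k * (y j - y k))" by (rule sum_nonneg) (rule nn[OF m[rule_format]])
    then have "(\<Sum>k\<in>UNIV. a i k * (y j - y k)) = 0" using le[of i] max[OF ij] eq by simp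
    then have "a i k * (y j - y k) = 0"
      using sum_nonneg_eq_0_iff[of UNIV "\<lambda>k. a i k * (y j - y k)"] nn[OF m[rule_format]] by simp
    then show "y k = y j" using a0 ik by simp
  next
    fix i j assume ij: "B $ i $ j \<noteq> 0" and nb: "\<not> branching B i"
    have z: "A $ i $ k = 0" if "k \<noteq> j" for k
      using that ij nb a0[of i k] by (auto simp: branching_def a_def)
    have "(\<Sum>k\<in>UNIV. A $ i $ k * x $ k) = (\<Sum>k\<in>{j}. A $ i $ k * x $ k)"
      by (rule sum.mono_neutral_right) (auto simp: z)
    moreover have "(\<Sum>k\<in>UNIV. a i k) = (\<Sum>k\<in>{j}. a i k)"
      by (rule sum.mono_neutral_right) (auto simp: z a_def)
    ultimately have "s * x $ i = A $ i $ j * x $ j" "a i j = B $ i $ j" using eig asum[OF ij] by simp_all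
    then show "?r * y i = B $ i $ j * y j"
      unfolding y_def a_def by (metis norm_mult)
  qed
qed

text \<open>The conditions only involve values of \<open>y\<close> on \<open>K\<close>, so they persist when \<open>y\<close> is changed outside \<open>K\<close>.\<close>

definition seed :: "real^'n^'n \<Rightarrow> real \<Rightarrow> 'n set \<Rightarrow> ('n \<Rightarrow> real) \<Rightarrow> bool" where
  "seed B r K y \<longleftrightarrow> K \<noteq> {} \<and> (\<forall>i\<in>K. 0 < y i \<and>
     (branching B i \<and> (\<exists>j\<in>K. r * y i < B $ i $ j * y j) \<or>
      (\<exists>j. B $ i $ j \<noteq> 0) \<and> (\<forall>j. B $ i $ j \<noteq> 0 \<longrightarrow> j \<in> K \<and> r * y i = B $ i $ j * y j)))"

text \<open>Without branching, the value at \<open>i\<close> is forced by the equality with its only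
  successor \<open>j\<close>. With branching, any positive value below it gives a strict inequality,
  and half of it is taken.\<close>

lemma seed_extend:
  assumes B: "nonneg_matrix B" and r: "0 < r" and K: "seed B r K y" and i: "i \<notin> K" "j \<in> K" "B $ i $ j \<noteq> 0"
  shows "\<exists>c. seed B r (insert i K) (y(i := c))"
proof -
  define c where "c = (if branching B i then 1 / 2 else 1) * (B $ i $ j * y j / r)"
  have Bpos: "0 < B $ i $ j" using nonneg_matrix_pos[OF B i(3)] .
  have yj: "0 < y j" using K i(2) by (simp add: seed_def)
  have c: "0 < c" using Bpos yj r by (simp add: c_def)
  have ij: "j \<noteq> i" using i by blast
  have "branching B i \<and> r * c < B $ i $ j * y j \<or>
      (\<forall>k. B $ i $ k \<noteq> 0 \<longrightarrow> k = j \<and> r * c = B $ i $ k * y k)"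
  proof (cases "branching B i")
    case True
    then show ?thesis using Bpos yj r by (simp add: c_def)
  next
    case False
    then have "k = j" if "B $ i $ k \<noteq> 0" for k using that i(3) by (auto simp: branching_def)
    then show ?thesis using False r by (auto simp: c_def)
  qed
  then have new: "branching B i \<and> r * c < B $ i $ j * y j \<or>
      (\<forall>k. B $ i $ k \<noteq> 0 \<longrightarrow> k = j \<and> r * c = B $ i $ k * y k)" .
  have upd: "(y(i := c)) k = y k" if "k \<in> K" for k using that i(1) by auto
  have "seed B r (insert i K) (y(i := c))"
    unfolding seed_def
  proof (intro conjI ballI)
    fix x assume "x \<in> insert i K"
    then consider "x = i" | "x \<in> K" by blast
    then have "0 < (y(i := c)) x \<and> (branching B x \<and> (\<exists>k\<in>insert i K. r * (y(i := c)) x < B $ x $ k * (y(i := c)) k) \<or>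
      (\<exists>k. B $ x $ k \<noteq> 0) \<and> (\<forall>k. B $ x $ k \<noteq> 0 \<longrightarrow> k \<in> insert i K \<and> r * (y(i := c)) x = B $ x $ k * (y(i := c)) k))"
    proof cases
      case 1
      have "(y(i := c)) x = c" using 1 by simp
      then show ?thesis using new c i(2,3) upd[OF i(2)] unfolding 1 by (metis insertCI)
    next
      case 2
      have "0 < y x" and "branching B x \<and> (\<exists>k\<in>K. r * y x < B $ x $ k * y k) \<or>
        (\<exists>k. B $ x $ k \<noteq> 0) \<and> (\<forall>k. B $ x $ k \<noteq> 0 \<longrightarrow> k \<in> K \<and> r * y x = B $ x $ k * y k)"
        using K 2 unfolding seed_def by blast+
      then show ?thesis unfolding upd[OF 2] using upd by (metis insertCI)
    qed
    then show "0 < (y(i := c)) x" "branching B x \<and> (\<exists>k\<in>insert i K. r * (y(i := c)) x < B $ x $ k * (y(i := c)) k) \<or>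
      (\<exists>k. B $ x $ k \<noteq> 0) \<and> (\<forall>k. B $ x $ k \<noteq> 0 \<longrightarrow> k \<in> insert i K \<and> r * (y(i := c)) x = B $ x $ k * (y(i := c)) k)"
      by (rule conjunct1, rule conjunct2)
  qed simp
  then show ?thesis by (rule exI[of _ c])
qed

text \<open>The seed grows backwards along edges, by induction on the number of nodes outside. When
  no outside node has an edge into \<open>K\<close>, the extension by zero is admissible: outside
  \<open>K\<close> a node vanishes together with all its successors.\<close>

lemma seed_imp_aux_spectrum:
  fixes B :: "real^'n^'n"
  assumes B: "nonneg_matrix B" "row_uniform B" and s: "s \<noteq> 0" and K: "seed B (cmod s) K y"
  shows "s \<in> aux_spectrum B"
  using K
proof (induction "card (- K)" arbitrary: K y rule: less_induct)
  case less
  let ?r = "cmod s"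
  have r: "0 < ?r" using s by simp
  show ?case
  proof (cases "\<exists>i j. i \<notin> K \<and> j \<in> K \<and> B $ i $ j \<noteq> 0")
    case True
    then obtain i j where ij: "i \<notin> K" "j \<in> K" "B $ i $ j \<noteq> 0" by blast
    obtain c where c: "seed B ?r (insert i K) (y(i := c))"
      using seed_extend[OF B(1) r less.prems ij] by blast
    have "card (- insert i K) < card (- K)" using ij by (intro psubset_card_mono) auto
    then show ?thesis using less.hyps c by blast
  next
    case False
    define z where "z i = (if i \<in> K then y i else 0)" for i
    have "0 \<le> z i" for i using less.prems by (auto simp: z_def seed_def intro: less_imp_le)
    moreover obtain i\<^sub>0 where "i\<^sub>0 \<in> K" using less.prems unfolding seed_def by blast
    then have "z i\<^sub>0 \<noteq> 0" using less.prems by (auto simp: z_def seed_def)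
    moreover have "admissible B ?r z i" for i
    proof (cases "i \<in> K")
      case True
      with less.prems have "0 < y i" and "branching B i \<and> (\<exists>j\<in>K. ?r * y i < B $ i $ j * y j) \<or>
        (\<exists>j. B $ i $ j \<noteq> 0) \<and> (\<forall>j. B $ i $ j \<noteq> 0 \<longrightarrow> j \<in> K \<and> ?r * y i = B $ i $ j * y j)"
        unfolding seed_def by blast+
      then show ?thesis using True unfolding admissible_def z_def by auto
    next
      case out: False
      then show ?thesis using False unfolding admissible_def z_def by auto
    qed
    ultimately show ?thesis using admissible_imp_aux_spectrum[OF B s] by blast
  qed
qed

section \<open>Potentials along walks and cycles\<close>

text \<open>The values are determined backwards from \<open>v\<close>. As no tail occurs twice or
  equals \<open>v\<close>, each new value is assigned at a node not met before.\<close>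

lemma open_walk_potential:
  fixes f :: "'n::finite \<times> 'n \<Rightarrow> real"
  assumes "walk_in B S u p v" "distinct (map fst p)" "v \<notin> fst ` set p" "\<forall>e\<in>set p. 0 < f e"
  shows "\<exists>y. (\<forall>x. 0 < y x) \<and> y v = 1 \<and> (\<forall>e\<in>set p. y (fst e) = f e * y (snd e))"
  using assms
proof (induction p arbitrary: u)
  case Nil
  show ?case by (rule exI[of _ "\<lambda>_. 1"]) simp
next
  case (Cons e p)
  have walk: "walk_in B S (snd e) p v" using Cons.prems(1) by simp
  obtain y where y: "\<And>x. 0 < y x" "y v = 1" "\<And>e. e \<in> set p \<Longrightarrow> y (fst e) = f e * y (snd e)"
  proof -
    have "\<exists>y. (\<forall>x. 0 < y x) \<and> y v = 1 \<and> (\<forall>e\<in>set p. y (fst e) = f e * y (snd e))"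
      by (rule Cons.IH[OF walk]) (use Cons.prems(2-) in auto)
    then show ?thesis using that by blast
  qed
  \<comment> \<open>The later nodes can be listed by tails or by heads, so distinct tails also keep
    \<open>fst e\<close> away from the heads of later arcs.\<close>
  have "fst e \<notin> set (map fst p @ [v])" using Cons.prems(2,3) by auto
  then have "fst e \<notin> set (snd e # map snd p)" unfolding walk_in_verts[OF walk] .
  then have "fst e \<noteq> snd e" and ne: "\<And>e'. e' \<in> set p \<Longrightarrow> fst e \<noteq> snd e'" by auto
  have "fst e \<notin> fst ` set p" using Cons.prems(2) by simp
  then have ne2: "\<And>e'. e' \<in> set p \<Longrightarrow> fst e \<noteq> fst e'" by (metis imageI)
  have fe: "0 < f e" using Cons.prems(4) by simp
  let ?y = "y(fst e := f e * y (snd e))"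
  have "?y (fst e') = f e' * ?y (snd e')" if "e' \<in> set p" for e'
    using y(3)[OF that] ne[OF that] ne2[OF that] by simp
  moreover have "?y (fst e) = f e * ?y (snd e)" using \<open>fst e \<noteq> snd e\<close> by simp
  moreover have "v \<noteq> fst e" using Cons.prems(3) by simp
  then have "?y v = 1" using y(2) by simp
  moreover have "0 < ?y x" for x using y(1) fe by simp
  ultimately have "(\<forall>x. 0 < ?y x) \<and> ?y v = 1 \<and> (\<forall>e'\<in>set (e # p). ?y (fst e') = f e' * ?y (snd e'))"
    by (simp only: list.set ball_simps) blast
  then show ?case by blast
qed

text \<open>The cycle is opened at its first arc. The potential on the remaining walk satisfies the
  equation of the removed arc precisely because the product of \<open>f\<close> around the cycle is
  1.\<close>

lemma cycle_potential:
  fixes f :: "'n::finite \<times> 'n \<Rightarrow> real"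
  assumes c: "cycle_in B S p" and f: "\<And>e. e \<in> set p \<Longrightarrow> 0 < f e" and one: "prod_list (map f p) = 1"
  shows "\<exists>y. (\<forall>x. 0 < y x) \<and> (\<forall>e\<in>set p. y (fst e) = f e * y (snd e))"
proof -
  obtain u where u: "walk_in B S u p u" using cycle_inD(2)[OF c] by blast
  obtain e q where p: "p = e # q" using cycle_inD(1)[OF c] by (cases p) auto
  have q: "walk_in B S (snd e) q u" and fe: "fst e = u" using u p by simp_all
  have d: "distinct (map fst q)" "u \<notin> fst ` set q" using cycle_inD(3)[OF c] p fe by auto
  have f': "\<forall>e\<in>set q. 0 < f e" using f p by simp
  obtain y where y: "\<And>x. 0 < y x" "y u = 1" "\<And>e. e \<in> set q \<Longrightarrow> y (fst e) = f e * y (snd e)"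
    using open_walk_potential[OF q d f'] by blast
  have "(\<Prod>e\<leftarrow>q. y (fst e)) = (\<Prod>e\<leftarrow>q. f e) * (\<Prod>e\<leftarrow>q. y (snd e))"
    using y(3) by (induction q) (auto simp: algebra_simps)
  moreover have "(\<Prod>e\<leftarrow>q. y (snd e)) \<noteq> 0" using y(1)
    by (simp add: prod_list_zero_iff image_iff) (metis less_irrefl)
  ultimately have "y (snd e) = prod_list (map f q)"
    using walk_in_telescope[OF q, of y] y(2) by simp
  then have "y (fst e) = f e * y (snd e)" using one p fe y(2) by simp
  then have "\<forall>e\<in>set p. y (fst e) = f e * y (snd e)" using y(3) p by simp
  then show ?thesis using y(1) by blast
qed

text \<open>A surplus \<open>?W > 1\<close> is absorbed by shrinking the weights at the branching
  nodes until the product is 1. In the resulting potential the shrunk nodes satisfy strict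
  inequalities and all other nodes of the cycle satisfy equalities with their only
  successor.\<close>

lemma cycle_seed:
  assumes B: "nonneg_matrix B" and c: "cycle_in B S p" and r: "0 < r"
    and h: "rel_weight B r p = 1 \<and> (\<forall>e\<in>set p. \<not> branching B (fst e)) \<or>
      1 < rel_weight B r p \<and> (\<exists>e\<in>set p. branching B (fst e))"
  shows "\<exists>y. seed B r (fst ` set p) y"
proof -
  let ?W = "rel_weight B r p"
  define n where "n = length (filter (\<lambda>e. branching B (fst e)) p)"
  \<comment> \<open>The surplus is divided evenly among the \<open>n\<close> branching nodes. If
    \<open>n\<close> is 0, then \<open>?W\<close> is 1 and the value of \<open>t\<close> is
    irrelevant.\<close>
  define t where "t = root n (1 / ?W)"
  have arcs: "set p \<subseteq> edges B" using cycle_inD(4)[OF c] by blast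
  have pos: "0 < B $ fst e $ snd e" if "e \<in> set p" for e
  proof -
    have "B $ fst e $ snd e \<noteq> 0" using subsetD[OF arcs that] edges_iff[of "fst e" "snd e" B] by simp
    then show ?thesis by (rule nonneg_matrix_pos[OF B])
  qed
  have t: "t ^ n * ?W = 1" "n \<noteq> 0 \<Longrightarrow> 0 < t \<and> t < 1"
  proof -
    show "n \<noteq> 0 \<Longrightarrow> 0 < t \<and> t < 1" using h by (auto simp: t_def n_def filter_empty_conv)
    show "t ^ n * ?W = 1"
    proof (cases "n = 0")
      case True
      then show ?thesis using h by (auto simp: n_def filter_empty_conv)
    next
      case False
      then show ?thesis using h by (auto simp: t_def)
    qed
  qed
  have tbr: "0 < t \<and> t < 1" if "e \<in> set p" "branching B (fst e)" for e
    using that t(2) by (auto simp: n_def filter_empty_conv)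
  define f where "f e = (if branching B (fst e) then t else 1) * (B $ fst e $ snd e / r)" for e
  have "prod_list (map f q) = t ^ length (filter (\<lambda>e. branching B (fst e)) q) * rel_weight B r q" for q
    by (induction q) (auto simp: f_def)
  then have "prod_list (map f p) = 1" using t(1) by (simp add: n_def)
  moreover have "0 < f e" if "e \<in> set p" for e
    using that tbr pos r by (auto simp: f_def)
  ultimately obtain y where y: "\<And>x. 0 < y x" "\<And>e. e \<in> set p \<Longrightarrow> y (fst e) = f e * y (snd e)"
    using cycle_potential[OF c] by blast
  have "seed B r (fst ` set p) y"
    unfolding seed_def
  proof (intro conjI ballI)
    show "fst ` set p \<noteq> {}" using cycle_inD(1)[OF c] by simp
  next
    fix i assume "i \<in> fst ` set p"
    then obtain j where e: "(i, j) \<in> set p" by auto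
    have j: "j \<in> fst ` set p" using e cycle_inD(5)[OF c] by force
    have Bij: "B $ i $ j \<noteq> 0" using e arcs by auto
    have bp: "0 < B $ i $ j" using pos[OF e] by simp
    show "0 < y i" by (rule y)
    show "branching B i \<and> (\<exists>j\<in>fst ` set p. r * y i < B $ i $ j * y j) \<or>
        (\<exists>j. B $ i $ j \<noteq> 0) \<and> (\<forall>j. B $ i $ j \<noteq> 0 \<longrightarrow> j \<in> fst ` set p \<and> r * y i = B $ i $ j * y j)"
    proof (cases "branching B i")
      case True
      then have "r * y i = t * (B $ i $ j * y j)" using y(2)[OF e] r by (simp add: f_def)
      also have "\<dots> < 1 * (B $ i $ j * y j)"
        using tbr[OF e] True y(1)[of j] bp by (intro mult_strict_right_mono) auto
      finally show ?thesis using True j by auto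
    next
      case False
      then have "k = j" if "B $ i $ k \<noteq> 0" for k using that Bij by (auto simp: branching_def)
      moreover have "r * y i = B $ i $ j * y j" using False y(2)[OF e] r by (simp add: f_def)
      ultimately show ?thesis using Bij j by blast
    qed
  qed
  then show ?thesis by (rule exI[of _ y])
qed

section \<open>The spectrum\<close>

text \<open>Among the nodes of \<open>T\<close>, one with the fewest reachable nodes is chosen. Each
  node reachable from it reaches a subset that is no smaller, hence the same set.\<close>

lemma terminal_component_exists:
  fixes T :: "'a::finite set"
  assumes "T \<noteq> {}" and closed: "H `` T \<subseteq> T"
  obtains K where "K \<noteq> {}" "K \<subseteq> T" "H `` K \<subseteq> K" "\<And>i j. i \<in> K \<Longrightarrow> j \<in> K \<Longrightarrow> (i, j) \<in> H\<^sup>*"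
proof -
  let ?R = "\<lambda>i. H\<^sup>* `` {i}"
  obtain i\<^sub>0 where "i\<^sub>0 \<in> T" using assms(1) by blast
  from ex_has_least_nat[of "\<lambda>i. i \<in> T", OF this, of "\<lambda>i. card (?R i)"]
  obtain i where i: "i \<in> T" and least: "\<And>j. j \<in> T \<Longrightarrow> card (?R i) \<le> card (?R j)"
    by blast
  have RT: "?R i \<subseteq> T"
  proof
    fix j assume "j \<in> ?R i"
    then have "(i, j) \<in> H\<^sup>*" by simp
    then show "j \<in> T" by (induction rule: rtrancl_induct) (use i closed in auto)
  qed
  show ?thesis
  proof
    show "?R i \<noteq> {}" by blast
    show "?R i \<subseteq> T" by (rule RT)
    show "H `` ?R i \<subseteq> ?R i" by (auto intro: rtrancl_into_rtrancl)
    fix j k assume j: "j \<in> ?R i" and k: "k \<in> ?R i"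
    have "?R j \<subseteq> ?R i" using j by (auto intro: rtrancl_trans)
    then have "?R j = ?R i" using least[of j] j RT by (intro card_seteq) auto
    then show "(j, k) \<in> H\<^sup>*" using k by blast
  qed
qed

text \<open>By finality two successors of \<open>i\<close> would give two arcs of the single cycle
  with the same tail.\<close>

lemma unicyclic_not_branching:
  assumes S: "final_class B S" "unicyclic B S" and i: "i \<in> S"
  shows "\<not> branching B i"
proof
  assume "branching B i"
  then obtain j k where jk: "j \<noteq> k" "B $ i $ j \<noteq> 0" "B $ i $ k \<noteq> 0" by (auto simp: branching_def)
  obtain p where p: "cycle_in B S p" "set p = edges B \<inter> S \<times> S"
    using S(2) unfolding unicyclic_def Let_def by auto
  have "j \<in> S" "k \<in> S" using S(1) i jk unfolding final_class_iff by metis+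
  then have "(i, j) \<in> set p" "(i, k) \<in> set p" using p(2) i jk by auto
  moreover have "inj_on fst (set p)" using cycle_inD(3)[OF p(1)] by (simp add: distinct_map)
  ultimately show False using inj_onD[of fst "set p" "(i, j)" "(i, k)"] jk(1) by simp
qed

lemma unicyclic_mu_pos:
  assumes "nonneg_matrix B" "unicyclic B S" shows "0 < mu B S"
proof -
  obtain p where p: "cycle_in B S p" using assms(2) unfolding unicyclic_def Let_def by auto
  show ?thesis using cycle_mean_pos[OF assms(1) p] cycle_mean_le_mu[OF p] by simp
qed

text \<open>A cycle without branching nodes is closed under successors. It would therefore fill its
  class, make it final and contain all its arcs, so the class would be final and unicyclic.\<close>

lemma cycle_branching:
  assumes S: "transient_class B S \<or> final_class B S \<and> multicyclic B S" and c: "cycle_in B S c"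
  shows "\<exists>e\<in>set c. branching B (fst e)"
proof (rule ccontr)
  assume nb: "\<not> ?thesis"
  let ?V = "fst ` set c"
  have cls: "S \<in> classes B" using S by (auto simp: transient_class_def final_class_def)
  have arcs: "set c \<subseteq> edges B \<inter> S \<times> S" by (rule cycle_inD(4)[OF c])
  have succ: "(i, k) \<in> set c" if i: "i \<in> ?V" and ik: "B $ i $ k \<noteq> 0" for i k
  proof -
    obtain j where j: "(i, j) \<in> set c" using i by auto
    then have "B $ i $ j \<noteq> 0" using arcs by auto
    moreover have "\<not> branching B i" using nb j by force
    ultimately show ?thesis using ik j by (metis branching_def)
  qed
  have VS: "?V \<subseteq> S" using arcs by auto
  have closed: "k \<in> ?V" if "i \<in> ?V" "B $ i $ k \<noteq> 0" for i k
    using imageI[OF succ[OF that], of snd] cycle_inD(5)[OF c] by simp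
  obtain v where v: "v \<in> ?V" using cycle_inD(1)[OF c] by (cases c) auto
  have "u \<in> ?V" if "u \<in> S" for u
  proof -
    have "(v, u) \<in> (edges B)\<^sup>*" using class_reachable[OF cls _ that] v VS by blast
    then show ?thesis by (induction rule: rtrancl_induct) (use v closed in auto)
  qed
  then have V: "?V = S" using VS by blast
  then have final: "final_class B S" using cls closed by (simp add: final_class_iff)
  have "set c = edges B \<inter> S \<times> S"
  proof
    show "edges B \<inter> S \<times> S \<subseteq> set c"
    proof
      fix e assume e: "e \<in> edges B \<inter> S \<times> S"
      obtain i k where ik: "e = (i, k)" by (cases e)
      show "e \<in> set c" unfolding ik by (rule succ) (use e ik V in simp_all)
    qed
  qed (rule arcs)
  then have "unicyclic B S" unfolding unicyclic_def Let_def using c V by auto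
  then show False using S final by (auto simp: transient_class_def multicyclic_def)
qed

text \<open>The potential at \<open>i\<close> is the relative weight of some walk from
  \<open>i\<close> to a fixed node. The choice of the walk does not matter because all closed walks
  have relative weight 1.\<close>

lemma class_seed:
  assumes B: "nonneg_matrix B" and S: "final_class B S" and r: "0 < r"
    and ex: "cycle_in B S c\<^sub>0" and mean: "\<And>c. cycle_in B S c \<Longrightarrow> cycle_mean B c = r"
  shows "\<exists>y. seed B r S y"
proof -
  have cls: "S \<in> classes B" and fin: "\<And>i j. i \<in> S \<Longrightarrow> B $ i $ j \<noteq> 0 \<Longrightarrow> j \<in> S"
    using S by (auto simp: final_class_iff)
  obtain e where e: "e \<in> set c\<^sub>0" using cycle_inD(1)[OF ex] by (cases c\<^sub>0) auto
  \<comment> \<open>A base point on a cycle has a successor, which is needed when \<open>S\<close>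
    is a single node.\<close>
  define a where "a = fst e"
  have "e \<in> edges B \<inter> S \<times> S" using e cycle_inD(4)[OF ex] by blast
  then have a: "a \<in> S" "B $ a $ snd e \<noteq> 0" by (cases e, simp add: a_def)+
  define p where "p i = (SOME p. walk_in B S i p a)" for i
  have p: "walk_in B S i (p i) a" if "i \<in> S" for i
    unfolding p_def using class_walk_in[OF cls that a(1)] by (metis someI_ex)
  define y where "y i = rel_weight B r (p i)" for i
  have walk_pos: "0 < rel_weight B r q" if "walk_in B S u q v" for u q v
    using rel_weight_pos[OF B r] walk_in_arcs[OF that] by blast
  have eq: "r * y i = B $ i $ j * y j" if i: "i \<in> S" and ij: "B $ i $ j \<noteq> 0" for i j
  proof -
    have j: "j \<in> S" using fin i ij by blast
    \<comment> \<open>The same return walk \<open>q\<close> closes both the walk chosen at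
      \<open>i\<close> and the one through \<open>j\<close>, so its weight cancels.\<close>
    obtain q where q: "walk_in B S a q i" using class_walk_in[OF cls a(1) i] by blast
    have "walk_in B S i (((i, j) # p j) @ q) i"
      using p[OF j] i j ij by (intro walk_in_append[OF _ q]) simp
    moreover have "walk_in B S i (p i @ q) i" by (rule walk_in_append[OF p[OF i] q])
    ultimately have "rel_weight B r (((i, j) # p j) @ q) = rel_weight B r (p i @ q)"
      using closed_walk_rel_weight_eq_1[OF B r _ mean] by metis
    then have "B $ i $ j / r * y j * rel_weight B r q = y i * rel_weight B r q"
      by (simp add: rel_weight_append y_def)
    then show ?thesis using walk_pos[OF q] r by (simp add: field_simps)
  qed
  have ex_succ: "\<exists>j. B $ i $ j \<noteq> 0" if i: "i \<in> S" for i
    using class_reachable[OF cls i a(1)]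
  proof (cases rule: converse_rtranclE)
    case base
    then show ?thesis using a(2) by blast
  next
    case (step z)
    then show ?thesis by auto
  qed
  have "seed B r S y"
    unfolding seed_def
  proof (intro conjI ballI)
    show "S \<noteq> {}" using a(1) by blast
    show "0 < y i" if "i \<in> S" for i using walk_pos[OF p[OF that]] by (simp add: y_def)
    show "branching B i \<and> (\<exists>j\<in>S. r * y i < B $ i $ j * y j) \<or>
      (\<exists>j. B $ i $ j \<noteq> 0) \<and> (\<forall>j. B $ i $ j \<noteq> 0 \<longrightarrow> j \<in> S \<and> r * y i = B $ i $ j * y j)"
      if "i \<in> S" for i
      using ex_succ[OF that] eq[OF that] fin[OF that] by (intro disjI2 conjI allI impI)
  qed
  then show ?thesis by (rule exI[of _ y])
qed

section \<open>Eigenvalues of modulus at least \<open>M_tilde\<close>\<close>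

text \<open>The inequalities of the single arcs are multiplied, which is sound as all factors are
  nonnegative. Combined with telescoping, this bounds the weights of walks from below.\<close>

lemma rel_weight_potential_le:
  assumes "nonneg_matrix B" "0 < r" "\<And>e. e \<in> set p \<Longrightarrow> 0 < y (snd e) \<and> 0 \<le> y (fst e) \<and> r * y (fst e) \<le> B $ fst e $ snd e * y (snd e)"
  shows "(\<Prod>e\<leftarrow>p. y (fst e)) \<le> rel_weight B r p * (\<Prod>e\<leftarrow>p. y (snd e))"
  using assms(3)
proof (induction p)
  case Nil
  show ?case by simp
next
  case (Cons e p)
  have e: "0 < y (snd e)" "0 \<le> y (fst e)" "y (fst e) \<le> B $ fst e $ snd e / r * y (snd e)"
    using Cons.prems[of e] assms(2) by (simp_all add: field_simps)
  have "0 \<le> (\<Prod>e\<leftarrow>p. y (fst e))" using Cons.prems by (intro prod_list_nonneg) auto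
  have "y (fst e) * (\<Prod>e\<leftarrow>p. y (fst e)) \<le>
      (B $ fst e $ snd e / r * y (snd e)) * (rel_weight B r p * (\<Prod>e\<leftarrow>p. y (snd e)))"
  proof (rule mult_mono)
    show "0 \<le> B $ fst e $ snd e / r * y (snd e)" using e by linarith
    show "(\<Prod>e\<leftarrow>p. y (fst e)) \<le> rel_weight B r p * (\<Prod>e\<leftarrow>p. y (snd e))"
      by (rule Cons.IH) (use Cons.prems in simp)
  qed fact+
  then show ?case by (simp add: mult_ac)
qed

lemma rel_weight_potential_eq:
  assumes "0 < r" "\<And>e. e \<in> set p \<Longrightarrow> r * y (fst e) = B $ fst e $ snd e * y (snd e)"
  shows "(\<Prod>e\<leftarrow>p. y (fst e)) = rel_weight B r p * (\<Prod>e\<leftarrow>p. y (snd e))"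
  using assms(2)
proof (induction p)
  case Nil
  show ?case by simp
next
  case (Cons e p)
  have "y (fst e) = B $ fst e $ snd e / r * y (snd e)"
    using Cons.prems[of e] assms(1) by (simp add: field_simps)
  then show ?case using Cons by simp
qed

text \<open>In a final unicyclic class the relations between the moduli are equalities; in any other
  class the hypothesis on \<open>M_tilde B\<close> bounds all cycle means by \<open>cmod s\<close>.
  Either way no edge of the terminal component can be strict.\<close>

lemma aux_spectrum_upper:
  fixes B :: "real^'n^'n"
  assumes B: "nonneg_matrix B" and s: "s \<in> aux_spectrum B" "s \<noteq> 0" and M: "M_tilde B \<le> cmod s"
  obtains S where "final_class B S" "mu B S = cmod s" "nu B S = cmod s"
proof -
  let ?r = "cmod s"
  have r: "0 < ?r" using s(2) by simp
  obtain y where y: "\<forall>i. 0 \<le> y i" "\<exists>i. 0 < y i"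
    "\<forall>i. 0 < y i \<longrightarrow> (\<exists>j. B $ i $ j \<noteq> 0)"
    "\<forall>i j. B $ i $ j \<noteq> 0 \<longrightarrow> (\<forall>k. B $ i $ k \<noteq> 0 \<longrightarrow> y k \<le> y j) \<longrightarrow> ?r * y i \<le> B $ i $ j * y j"
    "\<forall>i j k. B $ i $ j \<noteq> 0 \<longrightarrow> (\<forall>k. B $ i $ k \<noteq> 0 \<longrightarrow> y k \<le> y j) \<longrightarrow>
       ?r * y i = B $ i $ j * y j \<longrightarrow> B $ i $ k \<noteq> 0 \<longrightarrow> y k = y j"
    "\<forall>i j. B $ i $ j \<noteq> 0 \<longrightarrow> \<not> branching B i \<longrightarrow> ?r * y i = B $ i $ j * y j"
    by (rule aux_spectrum_moduli[OF s]) (rule that; assumption)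
  note y0 = y(1)[rule_format] y(2) and ysucc = y(3)[rule_format] and ynb = y(6)[rule_format]
  define T where "T = {i. 0 < y i}"
  \<comment> \<open>\<open>H\<close> keeps the edges to successors with the largest value. They
    never leave the support \<open>T\<close>, and every node of \<open>T\<close> has one.\<close>
  define H where "H = {(i, j). 0 < y i \<and> B $ i $ j \<noteq> 0 \<and> (\<forall>k. B $ i $ k \<noteq> 0 \<longrightarrow> y k \<le> y j)}"
  have H_iff: "(i, j) \<in> H \<longleftrightarrow> 0 < y i \<and> B $ i $ j \<noteq> 0 \<and> (\<forall>k. B $ i $ k \<noteq> 0 \<longrightarrow> y k \<le> y j)" for i j
    by (simp add: H_def)
  have H_le: "?r * y i \<le> B $ i $ j * y j" if "(i, j) \<in> H" for i j
    using that y(4)[THEN spec, THEN spec, of i j] by (simp add: H_iff)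
  have H_pos: "0 < y j" if "(i, j) \<in> H" for i j
  proof -
    have "0 < ?r * y i" using that r by (simp add: H_iff)
    then have "y j \<noteq> 0" using H_le[OF that] by auto
    then show ?thesis using y0(1)[of j] by simp
  qed
  have H_succ: "\<exists>j. (i, j) \<in> H" if "i \<in> T" for i
  proof -
    let ?E = "{j. B $ i $ j \<noteq> 0}"
    have i: "0 < y i" using that by (simp add: T_def)
    have E: "y ` ?E \<noteq> {}" using ysucc[OF i] by blast
    have "Max (y ` ?E) \<in> y ` ?E" by (rule Max_in[OF _ E]) simp
    then obtain j where j: "B $ i $ j \<noteq> 0" "Max (y ` ?E) = y j" by blast
    have "y k \<le> y j" if "B $ i $ k \<noteq> 0" for k
      unfolding j(2)[symmetric] by (rule Max_ge) (use that in auto)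
    then show ?thesis using i j(1) unfolding H_iff by blast
  qed
  have "T \<noteq> {}" using y0(2) by (simp add: T_def)
  moreover have "H `` T \<subseteq> T" using H_pos by (auto simp: T_def)
  ultimately obtain K where K: "K \<noteq> {}" "K \<subseteq> T" "H `` K \<subseteq> K"
    and K_conn: "\<And>i j. i \<in> K \<Longrightarrow> j \<in> K \<Longrightarrow> (i, j) \<in> H\<^sup>*"
    using terminal_component_exists by metis
  obtain i\<^sub>0 where i0: "i\<^sub>0 \<in> K" using K(1) by blast
  obtain S where S: "S \<in> classes B" "i\<^sub>0 \<in> S" by (rule class_exists)
  have HE: "H \<subseteq> edges B" by (auto simp: H_iff)
  have KS: "K \<subseteq> S"
  proof
    fix i assume "i \<in> K"
    then have "(i\<^sub>0, i) \<in> (edges B)\<^sup>*" "(i, i\<^sub>0) \<in> (edges B)\<^sup>*"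
      using K_conn[of i\<^sub>0 i] K_conn[of i i\<^sub>0] i0 rtrancl_mono[OF HE] by blast+
    then show "i \<in> S" by (rule class_closed[OF S])
  qed
  \<comment> \<open>An edge of \<open>H\<close> with strict inequality would lie on a closed walk of mean larger than \<open>cmod s\<close>.\<close>
  have H_eq: "?r * y i = B $ i $ j * y j" if ij: "(i, j) \<in> H" "i \<in> K" for i j
  proof (cases "final_class B S \<and> unicyclic B S")
    case True
    \<comment> \<open>\<open>M_tilde B\<close> does not bound the means of such a class, but a node
      with a single successor satisfies the equality anyway.\<close>
    then have "\<not> branching B i" using unicyclic_not_branching KS ij(2) by blast
    then show ?thesis using ynb ij(1) by (simp add: H_iff)
  next
    case False
    then have "transient_class B S \<or> final_class B S \<and> multicyclic B S"
      using S(1) by (auto simp: transient_class_def multicyclic_def)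
    then have "mu B S \<le> ?r" using le_M_tilde M order_trans by blast
    then have mean: "cycle_mean B c \<le> ?r" if "cycle_in B S c" for c
      using cycle_mean_le_mu[OF that] by simp
    \<comment> \<open>The return walk from \<open>j\<close> to \<open>i\<close> must consist of
      edges of \<open>H\<close>, since only for these is the inequality between the moduli
      available.\<close>
    define R where "R = H \<inter> K \<times> K"
    have RE: "R \<subseteq> edges B \<inter> S \<times> S" using HE KS by (auto simp: R_def)
    have j: "j \<in> K" using ij K(3) by blast
    have "(j, i) \<in> H\<^sup>*" by (rule K_conn[OF j ij(2)])
    then have "(j, i) \<in> R\<^sup>* \<and> i \<in> K"
    proof (induction rule: rtrancl_induct)
      case base
      show ?case using j by simp
    next
      case (step u v)
      then have "v \<in> K" using K(3) by blast
      then have "(u, v) \<in> R" using step by (simp add: R_def)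
      then show ?case using step.IH \<open>v \<in> K\<close> by (meson rtrancl_into_rtrancl)
    qed
    then have "(j, i) \<in> R\<^sup>*" ..
    then obtain p where p: "walk_in B S j p i" "set p \<subseteq> R"
      using rtrancl_imp_walk_in[OF _ RE] KS ij(2) by (metis subsetD)
    have q: "walk_in B S i ((i, j) # p) i"
      using p(1) ij KS j by (auto simp: H_iff)
    have W: "rel_weight B ?r ((i, j) # p) \<le> 1"
      by (rule closed_walk_rel_weight_le_1[OF B r q mean])
    have arc: "0 < y (snd e) \<and> 0 \<le> y (fst e) \<and> ?r * y (fst e) \<le> B $ fst e $ snd e * y (snd e)"
      if "e \<in> set p" for e
    proof -
      have "(fst e, snd e) \<in> H" using that p(2) by (auto simp: R_def)
      then show ?thesis using H_le H_pos y0(1) by blast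
    qed
    define a b where "a = (\<Prod>e\<leftarrow>p. y (fst e))" and "b = (\<Prod>e\<leftarrow>p. y (snd e))"
    have ab: "a \<le> rel_weight B ?r p * b"
      unfolding a_def b_def by (rule rel_weight_potential_le[OF B r arc])
    have yi: "0 < y i" and yj: "0 < y j" using ij(1) H_pos by (auto simp: H_iff)
    have "0 < b" using arc unfolding b_def by (induction p) auto
    have tele: "y i * a = y j * b"
      using walk_in_telescope[OF q, of y] yi by (simp add: a_def b_def mult.commute)
    then have "0 < y i * a" using \<open>0 < b\<close> yj by simp
    then have "0 < a" using yi by (simp add: zero_less_mult_iff)
    show ?thesis
    proof (rule antisym)
      show "?r * y i \<le> B $ i $ j * y j" by (rule H_le[OF ij(1)])
      \<comment> \<open>The lower bound for the weight of \<open>p\<close>, the upper bound 1 for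
        the closed walk and telescoping combine to the reverse inequality at the edge from
        \<open>i\<close> to \<open>j\<close>.\<close>
      have "B $ i $ j / ?r * y j * a \<le> B $ i $ j / ?r * y j * (rel_weight B ?r p * b)"
        using ab B r yj by (intro mult_left_mono) (auto simp: nonneg_matrix_def)
      also have "\<dots> = rel_weight B ?r ((i, j) # p) * (y j * b)" by simp
      also have "\<dots> \<le> 1 * (y j * b)" using W yj \<open>0 < b\<close> by (intro mult_right_mono) auto
      also have "\<dots> = y i * a" using tele by simp
      finally have "B $ i $ j / ?r * y j \<le> y i" using \<open>0 < a\<close> by (rule mult_right_le_imp_le)
      then show "B $ i $ j * y j \<le> ?r * y i" using r by (simp add: field_simps)
    qed
  qed
  \<comment> \<open>Equality forces \<open>y\<close> to be constant on the successors of
    \<open>i\<close>, so every edge leaving a node of \<open>K\<close> belongs to \<open>H\<close>.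
    Thus \<open>K\<close> is closed under all edges.\<close>
  have K_succ: "(i, k) \<in> H" if i: "i \<in> K" and ik: "B $ i $ k \<noteq> 0" for i k
  proof -
    obtain j where j: "(i, j) \<in> H" using H_succ i K(2) by blast
    then have "B $ i $ j \<noteq> 0" "\<forall>k. B $ i $ k \<noteq> 0 \<longrightarrow> y k \<le> y j" by (simp_all add: H_iff)
    then have "y k = y j"
      using H_eq[OF j i] ik
      by (rule y(5)[THEN spec, THEN spec, THEN spec, THEN mp, THEN mp, THEN mp, THEN mp, of i j k])
    then show ?thesis using j ik by (simp add: H_iff)
  qed
  have closed: "k \<in> K" if "i \<in> K" "B $ i $ k \<noteq> 0" for i k
    using K_succ[OF that] K(3) that(1) by blast
  have "S \<subseteq> K"
  proof
    fix i assume "i \<in> S"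
    have "(i\<^sub>0, i) \<in> (edges B)\<^sup>*" by (rule class_reachable[OF S \<open>i \<in> S\<close>])
    then show "i \<in> K" by (induction rule: rtrancl_induct) (use i0 closed in auto)
  qed
  then have SK: "S = K" using KS by blast
  have final: "final_class B S" unfolding final_class_iff using S(1) closed SK by simp
  have mean: "cycle_mean B c = ?r" if c: "cycle_in B S c" for c
  proof -
    obtain u where u: "walk_in B S u c u" using cycle_inD(2)[OF c] by blast
    have arcs: "fst e \<in> K \<and> B $ fst e $ snd e \<noteq> 0" if "e \<in> set c" for e
      using subsetD[OF cycle_inD(4)[OF c] that] SK by (cases e) simp
    have pos: "0 < y (snd e)" "0 < y (fst e)" if "e \<in> set c" for e
      using H_pos[OF K_succ] arcs[OF that] K(2) by (auto simp: T_def)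
    have "u \<in> fst ` set c" using u cycle_inD(1)[OF c] by (cases c) auto
    then have yu: "0 < y u" using pos(2) by auto
    have "(\<Prod>e\<leftarrow>c. y (fst e)) = rel_weight B ?r c * (\<Prod>e\<leftarrow>c. y (snd e))"
      using H_eq[OF K_succ] arcs by (intro rel_weight_potential_eq[OF r]) blast
    moreover have "(\<Prod>e\<leftarrow>c. y (fst e)) = (\<Prod>e\<leftarrow>c. y (snd e))"
      using walk_in_telescope[OF u, of y] yu by simp
    moreover have "0 < (\<Prod>e\<leftarrow>c. y (snd e))" using pos(1) by (induction c) auto
    ultimately have "rel_weight B ?r c = 1" by simp
    then show ?thesis using cycle_mean_compare[OF B c r] by simp
  qed
  \<comment> \<open>A cycle must be exhibited, since otherwise \<open>mu\<close> and
    \<open>nu\<close> would be the default 0.\<close>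
  obtain j where j: "(i\<^sub>0, j) \<in> H" using H_succ i0 K(2) by blast
  then have "j \<in> S" using i0 K(3) SK by blast
  then obtain p where "walk_in B S j p i\<^sub>0" using class_walk_in[OF S(1) _ S(2)] by blast
  then have "walk_in B S i\<^sub>0 ((i\<^sub>0, j) # p) i\<^sub>0" using j S(2) \<open>j \<in> S\<close> by (simp add: H_iff)
  then obtain c where "cycle_in B S c" by (rule cycle_in_exists) simp
  then have "mu B S = ?r" "nu B S = ?r" using mu_nu_eqI mean by blast+
  with final show ?thesis by (rule that)
qed

section \<open>Realising eigenvalues and combining the two cases\<close>

lemma aux_spectrum_of_cycle:
  assumes B: "nonneg_matrix B" "row_uniform B" and c: "cycle_in B S c" and s: "s \<noteq> 0"
    and h: "cmod s = cycle_mean B c \<and> (\<forall>e\<in>set c. \<not> branching B (fst e)) \<or>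
      cmod s < cycle_mean B c \<and> (\<exists>e\<in>set c. branching B (fst e))"
  shows "s \<in> aux_spectrum B"
proof -
  have r: "0 < cmod s" using s by simp
  have "rel_weight B (cmod s) c = 1 \<and> (\<forall>e\<in>set c. \<not> branching B (fst e)) \<or>
      1 < rel_weight B (cmod s) c \<and> (\<exists>e\<in>set c. branching B (fst e))"
    using h cycle_mean_compare[OF B(1) c r] by linarith
  from cycle_seed[OF B(1) c r this] show ?thesis
    using seed_imp_aux_spectrum[OF B s] by blast
qed

text \<open>The positive number \<open>M_tilde B\<close> is the mean of some cycle. Its surplus over
  \<open>cmod s\<close> can be absorbed because \<open>cycle_branching\<close> supplies a branching
  node on it.\<close>

lemma aux_spectrum_below_M_tilde:
  assumes B: "nonneg_matrix B" "row_uniform B" and s: "0 < cmod s" "cmod s < M_tilde B"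
  shows "s \<in> aux_spectrum B"
proof -
  obtain S where S: "transient_class B S \<or> final_class B S \<and> multicyclic B S" "mu B S = M_tilde B"
    using M_tilde_attained[of B] s by auto
  obtain c where c: "cycle_in B S c" "cycle_mean B c = mu B S"
    using mu_attained[of B S] s S(2) by auto
  show ?thesis
    by (rule aux_spectrum_of_cycle[OF B c(1)]) (use s S(2) c(2) cycle_branching[OF S(1) c(1)] in auto)
qed

lemma aux_spectrum_unicyclic:
  assumes B: "nonneg_matrix B" "row_uniform B" and S: "final_class B S" "unicyclic B S"
    and s: "cmod s = mu B S"
  shows "s \<in> aux_spectrum B - {0}"
proof -
  have mu: "0 < mu B S" by (rule unicyclic_mu_pos[OF B(1) S(2)])
  then obtain c where c: "cycle_in B S c" "cycle_mean B c = mu B S"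
    using mu_attained[of B S] by auto
  have "\<not> branching B (fst e)" if "e \<in> set c" for e
    using unicyclic_not_branching[OF S] cycle_inD(4)[OF c(1)] that by (metis IntD2 SigmaE fst_conv subsetD)
  moreover have "s \<noteq> 0" using mu s by auto
  ultimately show ?thesis using aux_spectrum_of_cycle[OF B c(1)] s c(2) by auto
qed

text \<open>The means of all cycles of \<open>S\<close> lie between \<open>nu B S\<close> and
  \<open>mu B S\<close>, hence equal \<open>cmod s\<close>, so the class itself carries a
  seed.\<close>

lemma aux_spectrum_at_mu:
  assumes B: "nonneg_matrix B" "row_uniform B" and S: "final_class B S" "mu B S = nu B S"
    and s: "0 < cmod s" "cmod s = mu B S"
  shows "s \<in> aux_spectrum B"
proof -
  obtain c where c: "cycle_in B S c" using mu_attained[of B S] s by auto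
  have "cycle_mean B c = cmod s" if "cycle_in B S c" for c
    using cycle_mean_le_mu[OF that] nu_le_cycle_mean[OF that] S(2) s(2) by simp
  from class_seed[OF B(1) S(1) s(1) c this] show ?thesis
    using seed_imp_aux_spectrum[OF B] s(1) by auto
qed

theorem theorem4p9:
  fixes B :: "real^'n^'n"
  assumes "nonneg_matrix B" and "row_uniform B"
  shows
    "((\<exists>S. final_class B S \<and> multicyclic B S \<and> mu B S = nu B S \<and> mu B S = M_tilde B) \<longrightarrow>
        aux_spectrum B - {0} =
          {s. 0 < cmod s \<and> cmod s \<le> M_tilde B} \<union>
          (\<Union>S\<in>{S. final_class B S \<and> unicyclic B S \<and> mu B S > M_tilde B}. {s. cmod s = mu B S}))
     \<and>
     (\<not> (\<exists>S. final_class B S \<and> multicyclic B S \<and> mu B S = nu B S \<and> mu B S = M_tilde B) \<longrightarrow>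
        aux_spectrum B - {0} =
          {s. 0 < cmod s \<and> cmod s < M_tilde B} \<union>
          (\<Union>S\<in>{S. final_class B S \<and> unicyclic B S \<and> mu B S \<ge> M_tilde B}. {s. cmod s = mu B S}))"
    (is "(?attained \<longrightarrow> _ = ?X) \<and> (\<not> ?attained \<longrightarrow> _ = ?Y)")
proof -
  have upper: "(?attained \<and> cmod s = M_tilde B) \<or>
      (\<exists>S. final_class B S \<and> unicyclic B S \<and> cmod s = mu B S)"
    if s: "s \<in> aux_spectrum B" "s \<noteq> 0" and M: "M_tilde B \<le> cmod s" for s
  proof -
    obtain S where S: "final_class B S" "mu B S = cmod s" "nu B S = cmod s"
      by (rule aux_spectrum_upper[OF assms(1) s M])
    show ?thesis
    proof (cases "unicyclic B S")
      case True
      then show ?thesis using S by metis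
    next
      case False
      then have m: "multicyclic B S" by (simp add: multicyclic_def)
      \<comment> \<open>A multicyclic final class counts towards \<open>M_tilde B\<close>. It can
        contribute only on the circle of radius \<open>M_tilde B\<close>, and then it witnesses that
        the maximum is attained in the required way.\<close>
      then have "mu B S \<le> M_tilde B" using S(1) le_M_tilde by blast
      then have eq: "cmod s = M_tilde B" using S(2) M by simp
      have "final_class B S \<and> multicyclic B S \<and> mu B S = nu B S \<and> mu B S = M_tilde B"
        using S m eq by simp
      then show ?thesis using eq by blast
    qed
  qed
  have at_M: "s \<in> aux_spectrum B" if a: "?attained" and s: "0 < cmod s" "cmod s = M_tilde B" for s
  proof -
    from a obtain S where "final_class B S" "mu B S = nu B S" "mu B S = M_tilde B" by blast
    then show ?thesis using aux_spectrum_at_mu[OF assms] s by metis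
  qed
  have X: "aux_spectrum B - {0} = ?X" if a: "?attained"
  proof (intro equalityI subsetI)
    fix s assume s: "s \<in> aux_spectrum B - {0}"
    show "s \<in> ?X"
    proof (cases "cmod s \<le> M_tilde B")
      case True
      then show ?thesis using s by simp
    next
      case False
      \<comment> \<open>Strictly outside the disc the first alternative of \<open>upper\<close> is
        impossible.\<close>
      then obtain S where "final_class B S \<and> unicyclic B S \<and> cmod s = mu B S"
        using upper[of s] s by auto
      then show ?thesis using False by auto
    qed
  next
    fix s assume "s \<in> ?X"
    then consider "0 < cmod s" "cmod s < M_tilde B" | "0 < cmod s" "cmod s = M_tilde B"
      | S where "final_class B S" "unicyclic B S" "cmod s = mu B S"
      by fastforce
    then show "s \<in> aux_spectrum B - {0}"
    proof cases
      case 1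
      then show ?thesis using aux_spectrum_below_M_tilde[OF assms] by auto
    next
      case 2
      then show ?thesis using at_M[OF a] by auto
    next
      case 3
      then show ?thesis using aux_spectrum_unicyclic[OF assms] by blast
    qed
  qed
  have Y: "aux_spectrum B - {0} = ?Y" if na: "\<not> ?attained"
  proof (intro equalityI subsetI)
    fix s assume s: "s \<in> aux_spectrum B - {0}"
    show "s \<in> ?Y"
    proof (cases "cmod s < M_tilde B")
      case True
      then show ?thesis using s by simp
    next
      case False
      \<comment> \<open>Here the failure of attainment excludes the first alternative of
        \<open>upper\<close>, even on the circle of radius \<open>M_tilde B\<close>.\<close>
      then obtain S where "final_class B S \<and> unicyclic B S \<and> cmod s = mu B S"
        using upper[of s] s na by auto
      then show ?thesis using False by auto
    qed
  next
    fix s assume "s \<in> ?Y"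
    then consider "0 < cmod s" "cmod s < M_tilde B"
      | S where "final_class B S" "unicyclic B S" "cmod s = mu B S"
      by fastforce
    then show "s \<in> aux_spectrum B - {0}"
    proof cases
      case 1
      then show ?thesis using aux_spectrum_below_M_tilde[OF assms] by auto
    next
      case 2
      then show ?thesis using aux_spectrum_unicyclic[OF assms] by blast
    qed
  qed
  show ?thesis using X Y by blast
qed

end
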